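(* There exists an uncountable family of under diagonal crooked maps $f\colon I\to I$ such that any two distinct members of the family are not topologically conjugate and have different sets of fixed points.
   Context: $I=[0,1]$. A map $f\colon I\to I$ is a continuous surjective function. It is under diagonal if $f(x)\le x$ for every $x\in[0,1]$. The set of fixed points of $f$ is $\mathrm{Fix}(f)=\{y\in I: f(y)=y\}$. Maps $f,g\colon I\to I$ are (topologically) conjugate if there is a homeomorphism $h\colon I\to I$ with $g=h\circ f\circ h^{-1}$. For $a,b\in I$ and $\delta>0$, a map $f$ is $\delta$-crooked between $a$ and $b$ if for every two points $c,d\in I$ with $f(c)=a$ and $f(d)=b$ there is a point $c'$ between $c$ and $d$ and a point $d'$ between $c'$ and $d$ such that $|b-f(c')|<\delta$ and $|a-f(d')|<\delta$ ("between" allows endpoints). The map $f$ is $\delta$-crooked if it is $\delta$-crooked between every pair of points of $I$. The map $f$ is crooked if for every $\delta>0$ there exists $n\in\mathbb N$ such that $f^n$ is $\delta$-crooked. *)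

theory Defs
  imports "HOL-Analysis.Analysis"
begin

abbreviation unit_interval :: "real set" where
  "unit_interval \<equiv> {0..1}"

text \<open>Functions are required to be extensional, so that two maps are equal in HOL
  exactly when they agree on the unit interval.\<close>

definition interval_map :: "(real \<Rightarrow> real) \<Rightarrow> bool" where
  "interval_map f \<longleftrightarrow>
     f \<in> extensional unit_interval \<and> continuous_on unit_interval f \<and>
     f ` unit_interval = unit_interval"

definition under_diagonal :: "(real \<Rightarrow> real) \<Rightarrow> bool" where
  "under_diagonal f \<longleftrightarrow> (\<forall>x\<in>unit_interval. f x \<le> x)"

definition Fix :: "(real \<Rightarrow> real) \<Rightarrow> real set" where
  "Fix f = {y \<in> unit_interval. f y = y}"

definition conjugate :: "(real \<Rightarrow> real) \<Rightarrow> (real \<Rightarrow> real) \<Rightarrow> bool" where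
  "conjugate f g \<longleftrightarrow>
     (\<exists>h h'. homeomorphism unit_interval unit_interval h h' \<and>
             (\<forall>x\<in>unit_interval. g x = h (f (h' x))))"

text \<open>The points \<open>c\<close> and \<open>d\<close> may come in either order; hence closed segments
  rather than intervals.\<close>

definition crooked_between :: "real \<Rightarrow> real \<Rightarrow> real \<Rightarrow> (real \<Rightarrow> real) \<Rightarrow> bool" where
  "crooked_between \<delta> a b f \<longleftrightarrow>
     (\<forall>c\<in>unit_interval. \<forall>d\<in>unit_interval. f c = a \<and> f d = b \<longrightarrow>
        (\<exists>c'\<in>closed_segment c d. \<exists>d'\<in>closed_segment c' d.
           \<bar>b - f c'\<bar> < \<delta> \<and> \<bar>a - f d'\<bar> < \<delta>))"

definition delta_crooked :: "real \<Rightarrow> (real \<Rightarrow> real) \<Rightarrow> bool" where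
  "delta_crooked \<delta> f \<longleftrightarrow>
     (\<forall>a\<in>unit_interval. \<forall>b\<in>unit_interval. crooked_between \<delta> a b f)"

definition crooked :: "(real \<Rightarrow> real) \<Rightarrow> bool" where
  "crooked f \<longleftrightarrow> (\<forall>\<delta>>0. \<exists>n::nat. delta_crooked \<delta> (f ^^ n))"

end

theory Submission
  imports Defs
begin

text \<open>An under diagonal map is built from left to right. Suppose it is crooked on \<open>[0, x]\<close>, and let
  it drift slowly downwards on \<open>[x, k']\<close>; then some iterate is crooked on \<open>[0, k']\<close>. Next let it sweep
  \<open>[k', k]\<close> over \<open>[z, k']\<close>, for a point \<open>z \<le> x\<close> whose orbit tends to 0, much more crookedly than the
  moduli of continuity of all iterates up to a large time. If the drift is so slow that \<open>z\<close> is almost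
  at 0 before \<open>k'\<close> has left the short interval \<open>[x, k']\<close>, then some iterate is crooked up to a
  multiple of \<open>e - x\<close> on the whole of \<open>[0, e]\<close>, however the map is continued on \<open>[k, e]\<close> with values
  at least \<open>k'\<close>. Infinitely many such stages converging to \<open>e\<close> give a crooked map on \<open>[0, e]\<close> with the
  new fixed point \<open>e\<close>.

  Crookedness of a fixed iterate on \<open>[0, p]\<close>, for a fixed point \<open>p\<close>, survives every continuation that
  stays close to \<open>p\<close>, so fixed points \<open>p\<^sub>0 < p\<^sub>1 < \<dots>\<close> can be added infinitely often. Immediately to the
  right of \<open>p\<^sub>k\<close> the map may be constant or not: an arbitrary set of natural numbers is stored in a
  conjugacy invariant way, while \<open>p\<^sub>0\<close>, the least positive fixed point, can be prescribed.\<close>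

subsection \<open>Crooked pairs of points\<close>

text \<open>The obstacle is that crookedness of a limit map has to be read off from finitely much of
  it: the exponent must be fixed before the rest of the map is known. Hence every estimate is
  uniform over all admissible continuations, and this makes both the inner limit (towards one new
  fixed point) and the outer one (over all fixed points) harmless. The price is that a segment
  reaching beyond \<open>k\<close> arrives over the fold \<open>[k', k]\<close> at an unknown time,
  while two demands compete: the low point of the fold must already have sunk to almost 0, and its
  high point must still be near the top. The slow drift reconciles them by providing a moment at
  which both hold. Two invariants are recorded because neither half of the claim implies the other:
  a homeomorphism may move fixed points, so different fixed point sets do not exclude conjugacy, and
  maps that are not conjugate may share their fixed points.\<close>

definition zigzag :: "real \<Rightarrow> (real \<Rightarrow> real) \<Rightarrow> real \<Rightarrow> real \<Rightarrow> bool" where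
  "zigzag \<delta> F c d \<longleftrightarrow> (\<exists>c'\<in>closed_segment c d. \<exists>d'\<in>closed_segment c' d.
     \<bar>F d - F c'\<bar> < \<delta> \<and> \<bar>F c - F d'\<bar> < \<delta>)"

text \<open>Passing from values to points with those values turns crookedness into a statement about
  single pairs, which can be moved, lifted and restricted to subsegments.\<close>

lemma delta_crooked_iff_zigzag:
  "delta_crooked \<delta> f \<longleftrightarrow> (\<forall>c\<in>{0..1}. \<forall>d\<in>{0..1}. f c \<in> {0..1} \<longrightarrow> f d \<in> {0..1} \<longrightarrow> zigzag \<delta> f c d)"
  unfolding delta_crooked_def crooked_between_def zigzag_def by blast

lemma zigzag_sym: "zigzag \<delta> F c d \<Longrightarrow> zigzag \<delta> F d c"
proof -
  assume "zigzag \<delta> F c d"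
  then obtain c' d' where *: "c' \<in> closed_segment c d" "d' \<in> closed_segment c' d"
    "\<bar>F d - F c'\<bar> < \<delta>" "\<bar>F c - F d'\<bar> < \<delta>"
    unfolding zigzag_def by blast
  have "d' \<in> closed_segment d c \<and> c' \<in> closed_segment d' c"
    using * by (auto simp: closed_segment_eq_real_ivl split: if_splits)
  then show ?thesis unfolding zigzag_def using * by blast
qed

lemma zigzag_mono: "zigzag \<delta> F c d \<Longrightarrow> \<delta> \<le> \<epsilon> \<Longrightarrow> zigzag \<epsilon> F c d"
  unfolding zigzag_def by force

lemma zigzag_cong:
  "zigzag \<delta> F c d \<Longrightarrow> (\<And>y. y \<in> closed_segment c d \<Longrightarrow> F y = G y) \<Longrightarrow> zigzag \<delta> G c d"
  unfolding zigzag_def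
  by (metis (no_types, lifting) ends_in_segment(1,2) subset_closed_segment subsetD)

lemma zigzag_close: "\<bar>F c - F d\<bar> < \<delta> \<Longrightarrow> zigzag \<delta> F c d"
  unfolding zigzag_def by (intro bexI[of _ c] bexI[of _ d]) auto

lemma zigzag_approx:
  assumes "zigzag \<delta> F c d" "\<And>y. y \<in> closed_segment c d \<Longrightarrow> \<bar>F y - G y\<bar> \<le> \<epsilon>"
  shows "zigzag (\<delta> + 2 * \<epsilon>) G c d"
proof -
  obtain c' d' where *: "c' \<in> closed_segment c d" "d' \<in> closed_segment c' d"
    "\<bar>F d - F c'\<bar> < \<delta>" "\<bar>F c - F d'\<bar> < \<delta>"
    using assms(1) unfolding zigzag_def by blast
  have "d' \<in> closed_segment c d"
    using * by (auto simp: closed_segment_eq_real_ivl split: if_splits)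
  then have "\<bar>F c' - G c'\<bar> \<le> \<epsilon>" "\<bar>F d' - G d'\<bar> \<le> \<epsilon>" "\<bar>F c - G c\<bar> \<le> \<epsilon>" "\<bar>F d - G d\<bar> \<le> \<epsilon>"
    using assms(2) * by auto
  then have "\<bar>G d - G c'\<bar> < \<delta> + 2 * \<epsilon>" "\<bar>G c - G d'\<bar> < \<delta> + 2 * \<epsilon>" using * by linarith+
  then show ?thesis unfolding zigzag_def using * by blast
qed

text \<open>If \<open>u\<close> precedes \<open>v\<close> on the way from \<open>c\<close> to
  \<open>d\<close>, the turning points of the inner pair serve the outer one; if \<open>v\<close>
  comes first, \<open>v\<close> and \<open>u\<close> themselves are the turning points.\<close>

lemma zigzag_sub:
  assumes "zigzag \<delta> F u v" "u \<in> closed_segment c d" "v \<in> closed_segment c d"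
    and "\<bar>F u - F c\<bar> \<le> \<epsilon>" "\<bar>F v - F d\<bar> \<le> \<epsilon>"
  shows "zigzag (\<delta> + \<epsilon>) F c d"
proof (cases "v \<in> closed_segment u d")
  case True
  obtain c' d' where *: "c' \<in> closed_segment u v" "d' \<in> closed_segment c' v"
    "\<bar>F v - F c'\<bar> < \<delta>" "\<bar>F u - F d'\<bar> < \<delta>"
    using assms(1) unfolding zigzag_def by blast
  have "c' \<in> closed_segment c d" "d' \<in> closed_segment c' d"
    using * True assms(2,3) by (auto simp: closed_segment_eq_real_ivl split: if_splits)
  moreover have "\<bar>F d - F c'\<bar> < \<delta> + \<epsilon>" "\<bar>F c - F d'\<bar> < \<delta> + \<epsilon>" using * assms(4,5) by linarith+
  ultimately show ?thesis unfolding zigzag_def by blast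
next
  case False
  then have "u \<in> closed_segment v d"
    using assms(2,3) by (auto simp: closed_segment_eq_real_ivl split: if_splits)
  moreover have "\<delta> > 0" using assms(1) unfolding zigzag_def by force
  then have "\<bar>F d - F v\<bar> < \<delta> + \<epsilon>" "\<bar>F c - F u\<bar> < \<delta> + \<epsilon>" using assms(4,5) by linarith+
  ultimately show ?thesis unfolding zigzag_def using assms(3) by blast
qed

text \<open>By the intermediate value theorem \<open>Q\<close> runs through the turning points of
  \<open>H\<close> in the required order. Precomposition thus preserves crookedness, so that later
  iterates inherit it from earlier ones.\<close>

lemma zigzag_lift:
  assumes "continuous_on (closed_segment c d) Q" "zigzag \<delta> H (Q c) (Q d)"
  shows "zigzag \<delta> (\<lambda>y. H (Q y)) c d"
proof -
  obtain u v where *: "u \<in> closed_segment (Q c) (Q d)" "v \<in> closed_segment u (Q d)"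
    "\<bar>H (Q d) - H u\<bar> < \<delta>" "\<bar>H (Q c) - H v\<bar> < \<delta>"
    using assms(2) unfolding zigzag_def by blast
  obtain c' where c': "c' \<in> closed_segment c d" "Q c' = u"
    using IVT'_closed_segment_real[OF *(1) assms(1)] by blast
  have "closed_segment c' d \<subseteq> closed_segment c d" using c' by (simp add: subset_closed_segment)
  then have "continuous_on (closed_segment c' d) Q" using assms(1) continuous_on_subset by blast
  then obtain d' where "d' \<in> closed_segment c' d" "Q d' = v"
    using IVT'_closed_segment_real[of v Q c' d] *(2) c' by blast
  then show ?thesis unfolding zigzag_def using c' * by blast
qed

text \<open>The form in which a fold is used: \<open>p\<close> and \<open>q\<close> need not be the
  images of \<open>c\<close> and \<open>d\<close>; it is enough that the segment passes over both
  and that \<open>H\<close> takes almost the right values there.\<close>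

lemma zigzag_via:
  assumes "continuous_on (closed_segment c d) Q" "p \<in> Q ` closed_segment c d"
    "q \<in> Q ` closed_segment c d" "zigzag \<delta> H p q"
    "\<bar>H p - H (Q c)\<bar> \<le> \<epsilon>" "\<bar>H q - H (Q d)\<bar> \<le> \<epsilon>"
  shows "zigzag (\<delta> + \<epsilon>) (\<lambda>y. H (Q y)) c d"
proof -
  obtain u v where *: "u \<in> closed_segment c d" "Q u = p" "v \<in> closed_segment c d" "Q v = q"
    using assms by auto
  have "closed_segment u v \<subseteq> closed_segment c d" using * by (simp add: subset_closed_segment)
  then have "continuous_on (closed_segment u v) Q" using assms(1) continuous_on_subset by blast
  then have "zigzag \<delta> (\<lambda>y. H (Q y)) u v" using zigzag_lift assms(4) * by blast
  then show ?thesis using zigzag_sub * assms(5,6) by blast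
qed

text \<open>It suffices to treat pairs at which \<open>F\<close> attains its extrema over the segment between them:
  among the pairs of points with the prescribed values, a closest one has this property.\<close>

lemma zigzag_reduce:
  assumes cont: "continuous_on (closed_segment c d) F"
    and ext: "\<And>u v. u \<in> closed_segment c d \<Longrightarrow> v \<in> closed_segment c d \<Longrightarrow> F u \<le> F v \<Longrightarrow>
      (\<And>w. w \<in> closed_segment u v \<Longrightarrow> F u \<le> F w \<and> F w \<le> F v) \<Longrightarrow> zigzag \<delta> F u v"
  shows "zigzag \<delta> F c d"
proof -
  have main: "zigzag \<delta> F a b" if ab: "F a \<le> F b" "closed_segment a b = closed_segment c d" for a b
  proof -
    let ?S = "closed_segment a b"
    have cS: "continuous_on ?S F" using cont unfolding ab(2) .
    define A where "A = {u \<in> ?S. F u = F a} \<times> {v \<in> ?S. F v = F b}"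
    have c1: "compact {u \<in> ?S. F u = y}" for y
    proof -
      have "closed ({u \<in> ?S. F u \<in> {y}})"
        using continuous_closed_preimage[OF cS closed_segment closed_singleton[of y]]
        by (simp add: vimage_def Int_def)
      then show ?thesis
        using compact_Int_closed[OF compact_segment[of a b], of "{u \<in> ?S. F u = y}"]
        by (simp add: Int_def conj_ac)
    qed
    have "compact A" unfolding A_def by (intro compact_Times c1)
    moreover have "A \<noteq> {}" unfolding A_def by auto
    moreover have "continuous_on A (\<lambda>p. \<bar>fst p - snd p\<bar>)" by (intro continuous_intros)
    ultimately have "\<exists>p\<in>A. \<forall>q\<in>A. \<bar>fst p - snd p\<bar> \<le> \<bar>fst q - snd q\<bar>"
      by (rule continuous_attains_inf)
    then obtain p where p: "p \<in> A" "\<And>q. q \<in> A \<Longrightarrow> \<bar>fst p - snd p\<bar> \<le> \<bar>fst q - snd q\<bar>"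
      by blast
    obtain u v where uv: "p = (u, v)" by force
    have u: "u \<in> ?S" "F u = F a" and v: "v \<in> ?S" "F v = F b" using p uv unfolding A_def by auto
    have min: "\<bar>u - v\<bar> \<le> \<bar>u' - v'\<bar>" if "u' \<in> ?S" "F u' = F a" "v' \<in> ?S" "F v' = F b" for u' v'
      using p(2)[of "(u', v')"] that uv unfolding A_def by auto
    have sub: "closed_segment u v \<subseteq> ?S" using u v by (simp add: subset_closed_segment)
    have "zigzag \<delta> F u v"
    proof (rule ext)
      show "u \<in> closed_segment c d" "v \<in> closed_segment c d" "F u \<le> F v"
        using u v ab by (simp_all only:)
      fix w assume w: "w \<in> closed_segment u v"
      have wS: "w \<in> ?S" using w sub by blast
      \<comment> \<open>A value outside \<open>[F u, F v]\<close> at \<open>w\<close> would, by the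
        intermediate value theorem, force a repetition of \<open>F u\<close> between
        \<open>w\<close> and \<open>v\<close>, or of \<open>F v\<close> between \<open>u\<close> and
        \<open>w\<close>, hence a strictly closer pair.\<close>
      show "F u \<le> F w \<and> F w \<le> F v"
      proof (rule ccontr)
        assume "\<not> ?thesis"
        then consider "F w < F u" | "F v < F w" by linarith
        then show False
        proof cases
          case 1
          have s: "closed_segment w v \<subseteq> closed_segment u v" using w by (simp add: subset_closed_segment)
          have "F u \<in> closed_segment (F w) (F v)"
            using 1 u v ab by (auto simp: closed_segment_eq_real_ivl)
          then obtain u' where u': "u' \<in> closed_segment w v" "F u' = F u"
            using IVT'_closed_segment_real[of "F u" F w v] s sub cS continuous_on_subset by (metis subset_trans)
          have "\<bar>u - v\<bar> \<le> \<bar>u' - v\<bar>" using min u' s sub u v by (metis subsetD)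
          then have "u' = u \<or> w = u" using u' w
            by (auto simp: closed_segment_eq_real_ivl split: if_splits)
          then have "w = u" using u' w by (auto simp: closed_segment_eq_real_ivl split: if_splits)
          then show False using 1 by simp
        next
          case 2
          have s: "closed_segment u w \<subseteq> closed_segment u v" using w by (simp add: subset_closed_segment)
          have "F v \<in> closed_segment (F u) (F w)"
            using 2 u v ab by (auto simp: closed_segment_eq_real_ivl)
          then obtain v' where v': "v' \<in> closed_segment u w" "F v' = F v"
            using IVT'_closed_segment_real[of "F v" F u w] s sub cS continuous_on_subset by (metis subset_trans)
          have "\<bar>u - v\<bar> \<le> \<bar>u - v'\<bar>" using min v' s sub u v by (metis subsetD)
          then have "v' = v \<or> w = v" using v' w
            by (auto simp: closed_segment_eq_real_ivl split: if_splits)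
          then have "w = v" using v' w by (auto simp: closed_segment_eq_real_ivl split: if_splits)
          then show False using 2 by simp
        qed
      qed
    qed
    then have "zigzag (\<delta> + 0) F a b" by (rule zigzag_sub) (use u v in simp_all)
    then show ?thesis by simp
  qed
  show ?thesis
  proof (cases "F c \<le> F d")
    case True then show ?thesis using main by blast
  next
    case False
    then have "zigzag \<delta> F d c" using main[of d c] by (simp add: closed_segment_commute)
    then show ?thesis by (rule zigzag_sym)
  qed
qed

subsection \<open>A crooked surjection onto an interval\<close>

text \<open>The folding pattern of the crooked chains that define the pseudo-arc, as a map onto
  \<open>[0, n]\<close>: to get from level 0 to n + 2, climb crookedly to n + 1, return crookedly to
  1, then climb crookedly to the top. The middle third is run backwards, whence
  \<open>2 - 3 * t\<close>.\<close>

fun crook :: "nat \<Rightarrow> real \<Rightarrow> real" where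
  "crook 0 t = 0"
| "crook (Suc 0) t = t"
| "crook (Suc (Suc n)) t =
    (if t \<le> 1/3 then crook (Suc n) (3 * t)
     else if t \<le> 2/3 then 1 + crook n (2 - 3 * t)
     else 1 + crook (Suc n) (3 * t - 2))"

lemma crook_ends [simp]: "crook n 0 = 0" "crook n 1 = real n"
proof -
  have "crook n 0 = 0 \<and> crook n 1 = real n"
    by (induction n rule: induct_nat_012) auto
  then show "crook n 0 = 0" "crook n 1 = real n" by auto
qed

lemma crook_middle:
  assumes "t \<in> {1/3..2/3}"
  shows "crook (Suc (Suc n)) t = 1 + crook n (2 - 3 * t)"
proof (cases "t = 1/3")
  case True
  show ?thesis unfolding True by simp
qed (use assms in auto)

lemma crook_right:
  assumes "t \<in> {2/3..1}"
  shows "crook (Suc (Suc n)) t = 1 + crook (Suc n) (3 * t - 2)"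
proof (cases "t = 2/3")
  case True
  show ?thesis unfolding True by simp
qed (use assms in auto)

lemma crook_range: "t \<in> {0..1} \<Longrightarrow> crook n t \<in> {0..real n}"
proof (induction n arbitrary: t rule: less_induct)
  case (less n)
  show ?case
  proof (cases "n < 2")
    case True
    then have "n = 0 \<or> n = 1" by auto
    then show ?thesis using less.prems by auto
  next
    case False
    then obtain k where *: "n = Suc (Suc k)"
      by (metis One_nat_def add_2_eq_Suc le_Suc_ex not_less)
    have "3 * t \<in> {0..1}" if "t \<le> 1/3" using that less.prems by auto
    moreover have "2 - 3 * t \<in> {0..1}" if "\<not> t \<le> 1/3" "t \<le> 2/3" using that by auto
    moreover have "3 * t - 2 \<in> {0..1}" if "\<not> t \<le> 2/3" using that less.prems by auto
    ultimately show ?thesis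
      using less.IH[of "Suc k" "3 * t"] less.IH[of k "2 - 3 * t"] less.IH[of "Suc k" "3 * t - 2"] *
      by (auto split: if_splits)
  qed
qed

text \<open>In the construction this says that the sweep attains \<open>k'\<close> at
  \<open>k\<close> and no earlier, so that an image in \<open>[k', e]\<close> reveals a preimage in
  \<open>[k, e]\<close>.\<close>

lemma crook_less: "n > 0 \<Longrightarrow> t \<in> {0..<1} \<Longrightarrow> crook n t < real n"
proof (induction n arbitrary: t rule: less_induct)
  case (less n)
  show ?case
  proof (cases "n < 2")
    case True
    then have "n = 0 \<or> n = 1" by auto
    then show ?thesis using less.prems by auto
  next
    case False
    then obtain k where *: "n = Suc (Suc k)"
      by (metis One_nat_def add_2_eq_Suc le_Suc_ex not_less)
    have 1: "3 * t \<in> {0..1}" if "t \<le> 1/3" using that less.prems by auto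
    have 2: "2 - 3 * t \<in> {0..1}" if "\<not> t \<le> 1/3" "t \<le> 2/3" using that by auto
    have 3: "3 * t - 2 \<in> {0..<1}" if "\<not> t \<le> 2/3" using that less.prems by auto
    show ?thesis
      using less.IH[of "Suc k" "3 * t - 2"] * 3 crook_range[of "3 * t" "Suc k"] 1
        crook_range[of "2 - 3 * t" k] 2
      by (auto split: if_splits)
  qed
qed

lemma continuous_on_crook: "continuous_on {0..1} (crook n)"
proof (induction n rule: less_induct)
  case (less n)
  show ?case
  proof (cases "n < 2")
    case True
    then have "n = 0 \<or> n = 1" by auto
    then show ?thesis by auto
  next
    case False
    then obtain k where *: "n = Suc (Suc k)"
      by (metis One_nat_def add_2_eq_Suc le_Suc_ex not_less)
    have c1: "continuous_on {0..1} (crook (Suc k))" and c2: "continuous_on {0..1} (crook k)"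
      using less * by auto
    have A: "continuous_on {0..1/3} (\<lambda>t. crook (Suc k) (3 * t))"
      by (rule continuous_on_compose2[OF c1]) (auto intro!: continuous_intros)
    have B: "continuous_on {1/3..2/3} (\<lambda>t. 1 + crook k (2 - 3 * t))"
      by (rule continuous_on_add[OF continuous_on_const continuous_on_compose2[OF c2]])
        (auto intro!: continuous_intros)
    have C: "continuous_on {2/3..1} (\<lambda>t. 1 + crook (Suc k) (3 * t - 2))"
      by (rule continuous_on_add[OF continuous_on_const continuous_on_compose2[OF c1]])
        (auto intro!: continuous_intros)
    have A': "continuous_on {0..1/3} (crook n)"
      using A by (rule continuous_on_eq) (auto simp: *)
    have B': "continuous_on {1/3..2/3} (crook n)"
      using B by (rule continuous_on_eq) (simp only: * crook_middle)
    have C': "continuous_on {2/3..1} (crook n)"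
      using C by (rule continuous_on_eq) (simp only: * crook_right)
    have "continuous_on (({0..1/3} \<union> {1/3..2/3}) \<union> {2/3..1}) (crook n)"
      by (intro continuous_on_closed_Un A' B' C' closed_Un closed_atLeastAtMost)
    moreover have "({0..1/3} \<union> {1/3..2/3}) \<union> {2/3..1} = {0..1::real}" by auto
    ultimately show ?thesis by simp
  qed
qed

lemma crook_third: "crook (Suc (Suc n)) (1/3) = real n + 1" "crook (Suc (Suc n)) (2/3) = 1"
  by simp_all

text \<open>For an extremal pair across exactly one of 1/3 and 2/3, the value there is the extreme
  one, so an endpoint shares it and the pair can be moved into a single third. Across both, a rising
  pair has these two points as witnesses, off by at most one level, hence by less than 2.\<close>

lemma zigzag_crook:
  assumes "c \<in> {0..1}" "d \<in> {0..1}"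
  shows "zigzag 2 (crook n) c d"
  using assms
proof (induction n arbitrary: c d rule: less_induct)
  case (less n)
  show ?case
  proof (cases "n < 2")
    case True
    then have "n = 0 \<or> n = 1" by auto
    then show ?thesis using less.prems by (auto intro!: zigzag_close)
  next
    case False
    then obtain k where *: "n = Suc (Suc k)"
      by (metis One_nat_def add_2_eq_Suc le_Suc_ex not_less)
    have sub: "closed_segment c d \<subseteq> {0..1}" using less.prems
      by (auto simp: closed_segment_eq_real_ivl split: if_splits)
    have cont: "continuous_on (closed_segment c d) (crook n)"
      using sub continuous_on_crook continuous_on_subset by blast
    have ra: "crook n t \<in> {0..k + 1}" if "t \<in> {0..1/3}" for t
      using that crook_range[of "3 * t" "Suc k"] * by auto
    have rb: "crook n t \<in> {1..k + 1}" if "t \<in> {1/3..2/3}" for t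
      using that crook_range[of "2 - 3 * t" k] unfolding * crook_middle[OF that] by auto
    have rc: "crook n t \<in> {1..k + 2}" if "t \<in> {2/3..1}" for t
      using that crook_range[of "3 * t - 2" "Suc k"] unfolding * crook_right[OF that] by auto
    have ia: "zigzag 2 (crook n) u v" if "u \<in> {0..1/3}" "v \<in> {0..1/3}" for u v
    proof -
      have s: "closed_segment u v \<subseteq> {0..1/3}"
        using that by (auto simp: closed_segment_eq_real_ivl split: if_splits)
      have "zigzag 2 (\<lambda>t. crook (Suc k) (3 * t)) u v"
        by (rule zigzag_lift) (use that * less.IH[of "Suc k"] in \<open>auto intro!: continuous_intros\<close>)
      then show ?thesis by (rule zigzag_cong) (use s * in auto)
    qed
    have ib: "zigzag 2 (crook n) u v" if "u \<in> {1/3..2/3}" "v \<in> {1/3..2/3}" for u v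
    proof -
      have s: "closed_segment u v \<subseteq> {1/3..2/3}"
        using that by (auto simp: closed_segment_eq_real_ivl split: if_splits)
      have "zigzag 2 (\<lambda>t. crook k (2 - 3 * t)) u v"
        by (rule zigzag_lift) (use that * less.IH[of k] in \<open>auto intro!: continuous_intros\<close>)
      then have "zigzag 2 (\<lambda>t. 1 + crook k (2 - 3 * t)) u v" by (simp add: zigzag_def)
      then show ?thesis by (rule zigzag_cong) (simp add: * crook_middle[OF subsetD[OF s]] del: crook.simps)
    qed
    have ic: "zigzag 2 (crook n) u v" if "u \<in> {2/3..1}" "v \<in> {2/3..1}" for u v
    proof -
      have s: "closed_segment u v \<subseteq> {2/3..1}"
        using that by (auto simp: closed_segment_eq_real_ivl split: if_splits)
      have "zigzag 2 (\<lambda>t. crook (Suc k) (3 * t - 2)) u v"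
        by (rule zigzag_lift) (use that * less.IH[of "Suc k"] in \<open>auto intro!: continuous_intros\<close>)
      then have "zigzag 2 (\<lambda>t. 1 + crook (Suc k) (3 * t - 2)) u v" by (simp add: zigzag_def)
      then show ?thesis by (rule zigzag_cong) (simp add: * crook_right[OF subsetD[OF s]] del: crook.simps)
    qed
    have n1: "crook n (1/3) = k + 1" and n2: "crook n (2/3) = 1" using * crook_third by auto
    \<comment> \<open>\<open>min\<close> and \<open>max\<close> cover rising and falling pairs
      alike, so only the order of the points is assumed.\<close>
    have lohi: "zigzag 2 (crook n) u v"
      if uv: "u \<in> {0..1}" "v \<in> {0..1}" "u \<le> v" "crook n u = a" "crook n v = b"
        and ext: "\<And>w. w \<in> {u..v} \<Longrightarrow> min a b \<le> crook n w \<and> crook n w \<le> max a b" for u v a b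
    proof -
      have seg: "closed_segment u v = {u..v}" using uv by (simp add: closed_segment_eq_real_ivl)
      consider "v \<le> 1/3" | "2/3 \<le> u" | "1/3 \<le> u" "v \<le> 2/3" | "u < 1/3" "1/3 < v" "v \<le> 2/3"
        | "1/3 \<le> u" "u < 2/3" "2/3 < v" | "u < 1/3" "2/3 < v"
        by linarith
      then show ?thesis
      proof cases
        case 1 then show ?thesis using ia uv by auto
      next
        case 2 then show ?thesis using ic uv by auto
      next
        case 3 then show ?thesis using ib uv by auto
      next
        case 4
        have "a \<le> k + 1" "b \<le> k + 1" using ra[of u] rb[of v] uv 4 by auto
        moreover have "k + 1 \<le> max a b" using ext[of "1/3"] 4 n1 by auto
        ultimately consider "a = k + 1" | "b = k + 1" by linarith
        then show ?thesis
        proof cases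
          case 1
          then show ?thesis using zigzag_sub[OF ib[of "1/3" v], of u v 0] 4 uv n1 by (auto simp: seg)
        next
          case 2
          then show ?thesis using zigzag_sub[OF ia[of u "1/3"], of u v 0] 4 uv n1 by (auto simp: seg)
        qed
      next
        case 5
        have "1 \<le> a" "1 \<le> b" using rb[of u] rc[of v] uv 5 by auto
        moreover have "min a b \<le> 1" using ext[of "2/3"] 5 n2 by auto
        ultimately consider "a = 1" | "b = 1" by linarith
        then show ?thesis
        proof cases
          case 1
          then show ?thesis using zigzag_sub[OF ic[of "2/3" v], of u v 0] 5 uv n2 by (auto simp: seg)
        next
          case 2
          then show ?thesis using zigzag_sub[OF ib[of u "2/3"], of u v 0] 5 uv n2 by (auto simp: seg)
        qed
      next
        case 6
        have e: "min a b \<le> 1" "k + 1 \<le> max a b"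
          using ext[of "1/3"] ext[of "2/3"] 6 n1 n2 by auto
        have r: "0 \<le> a" "a \<le> k + 1" "1 \<le> b" "b \<le> k + 2" using ra[of u] rc[of v] uv 6 by auto
        show ?thesis
        proof (cases "a \<le> b")
          case True
          then have "\<bar>b - crook n (1/3)\<bar> < 2" "\<bar>a - crook n (2/3)\<bar> < 2"
            using e r n1 n2 by auto
          moreover have "1/3 \<in> closed_segment u v" "2/3 \<in> closed_segment (1/3) v"
            using 6 by (auto simp: closed_segment_eq_real_ivl)
          ultimately show ?thesis unfolding zigzag_def using uv(4,5) by blast
        next
          case False
          \<comment> \<open>A falling pair across the middle third can only run from the maximum of
            the first third to the minimum of the last one, so it has the values of the pair 1/3,
            2/3.\<close>
          then have "a = k + 1" "b = 1" using e r by auto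
          then show ?thesis
            using zigzag_sub[OF ib[of "1/3" "2/3"], of u v 0] 6 uv n1 n2 by (auto simp: seg)
        qed
      qed
    qed
    show ?thesis
    proof (rule zigzag_reduce[OF cont])
      fix u v assume h: "u \<in> closed_segment c d" "v \<in> closed_segment c d" "crook n u \<le> crook n v"
        "\<And>w. w \<in> closed_segment u v \<Longrightarrow> crook n u \<le> crook n w \<and> crook n w \<le> crook n v"
      have uv: "u \<in> {0..1}" "v \<in> {0..1}" using h sub by auto
      show "zigzag 2 (crook n) u v"
      proof (cases "u \<le> v")
        case True
        show ?thesis by (rule lohi[OF uv True refl refl])
          (use h True in \<open>auto simp: closed_segment_eq_real_ivl\<close>)
      next
        case False
        then have vu: "v \<le> u" by simp
        have "zigzag 2 (crook n) v u" by (rule lohi[OF uv(2,1) vu refl refl])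
          (use h False in \<open>auto simp: closed_segment_eq_real_ivl\<close>)
        then show ?thesis by (rule zigzag_sym)
      qed
    qed
  qed
qed

subsection \<open>Iterates of under diagonal maps\<close>

text \<open>Partial constructions are total functions of which only the values on
  \<open>[0, x]\<close> count; as this interval is invariant, iteration makes sense there.
  Surjectivity comes at the very end, when the right end is fixed.\<close>

definition subdiagonal :: "real \<Rightarrow> (real \<Rightarrow> real) \<Rightarrow> bool" where
  "subdiagonal x f \<longleftrightarrow> continuous_on {0..x} f \<and> (\<forall>y\<in>{0..x}. 0 \<le> f y \<and> f y \<le> y)"

lemma subdiagonal_iterate:
  assumes "subdiagonal x f" "y \<in> {0..x}"
  shows "(f ^^ n) y \<in> {0..y}"
  using assms by (induction n) (auto simp: subdiagonal_def intro: order_trans)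

lemma subdiagonal_iterate_mem:
  assumes "subdiagonal x f" "y \<in> {0..x}"
  shows "(f ^^ n) y \<in> {0..x}"
  using subdiagonal_iterate[OF assms, of n] assms(2) by auto

lemma subdiagonal_iterate_antimono:
  assumes "subdiagonal x f" "y \<in> {0..x}" "m \<le> n"
  shows "(f ^^ n) y \<le> (f ^^ m) y"
proof -
  have "(f ^^ n) y = (f ^^ (n - m)) ((f ^^ m) y)"
    using assms(3) by (metis funpow_add o_apply le_add_diff_inverse2)
  then show ?thesis
    using subdiagonal_iterate[OF assms(1) subdiagonal_iterate_mem[OF assms(1,2)], of "n - m" m] by auto
qed

lemma continuous_on_iterate:
  assumes "subdiagonal x f"
  shows "continuous_on {0..x} (f ^^ n)"
proof (induction n)
  case (Suc n)
  have "continuous_on {0..x} (\<lambda>y. f ((f ^^ n) y))"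
    by (rule continuous_on_compose2[OF _ Suc, of "{0..x}"])
      (use assms subdiagonal_iterate_mem[OF assms] in \<open>auto simp: subdiagonal_def simp del: atLeastAtMost_iff\<close>)
  then show ?case by (simp add: o_def)
qed (simp add: id_def)

text \<open>Orbits never leave \<open>[0, x]\<close>, so exponents and moduli computed for a partial
  map stay valid for all its extensions.\<close>

lemma iterate_cong:
  assumes "subdiagonal x f" "\<And>y. y \<in> {0..x} \<Longrightarrow> g y = f y" "y \<in> {0..x}"
  shows "(g ^^ n) y = (f ^^ n) y"
  by (induction n) (use assms subdiagonal_iterate_mem[OF assms(1,3)] in auto)

text \<open>The map \<open>g\<close> sweeps \<open>[k', k]\<close> crookedly over \<open>[z, k']\<close>,
  touching \<open>z\<close> at \<open>m\<close>; here \<open>z\<close> falls below \<open>\<delta>\<close> within \<open>i\<close> steps, during which \<open>k'\<close> stays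
  above \<open>x\<close>, hence within \<open>\<delta>\<close> of the right end \<open>e\<close>.  The proof inspects the last time at which
  the image of the segment meets \<open>[k', e]\<close>: the part of the segment then lying over \<open>[k', k]\<close>
  is folded by the sweep.\<close>

lemma zigzag_iterate:
  fixes g :: "real \<Rightarrow> real"
  assumes sd: "subdiagonal e g"
    and pts: "0 \<le> x" "x \<le> k'" "k' < m" "m < k" "k \<le> e" "e - x \<le> \<delta>" "0 < \<delta>"
    and low: "\<And>w. w \<in> {0..<k} \<Longrightarrow> g w < k'"
    and high: "\<And>w. w \<in> {k..e} \<Longrightarrow> k' \<le> g w"
    and gm: "g m = z" and gk: "g k = k'"
    and left: "\<And>w. w \<in> {0..m} \<Longrightarrow> g w \<le> g k'"
    and rec: "\<And>l w. w \<in> {0..k'} \<Longrightarrow> (g ^^ l) w \<le> (g ^^ l) k'"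
    and rec': "\<And>l w. w \<in> {0..g k'} \<Longrightarrow> (g ^^ l) w \<le> (g ^^ l) (g k')"
    and top: "\<And>l. l \<le> i \<Longrightarrow> x \<le> (g ^^ l) k'"
    and bot: "\<And>l. i \<le> l \<Longrightarrow> (g ^^ l) z \<le> \<delta>"
    and crM: "\<And>c d. c \<in> {0..k'} \<Longrightarrow> d \<in> {0..k'} \<Longrightarrow> zigzag \<delta> (g ^^ M) c d"
    and N: "M < N" "i < N"
    and fold: "\<And>l c d. l \<le> N \<Longrightarrow> c \<in> {k'..k} \<Longrightarrow> d \<in> {k'..k} \<Longrightarrow> zigzag \<delta> (g ^^ Suc l) c d"
    and cd: "c \<in> {0..e}" "d \<in> {0..e}"
  shows "zigzag (3 * \<delta>) (g ^^ N) c d"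
proof (rule zigzag_reduce)
  have sub0: "closed_segment c d \<subseteq> {0..e}" using cd
    by (auto simp: closed_segment_eq_real_ivl split: if_splits)
  show "continuous_on (closed_segment c d) (g ^^ N)"
    using continuous_on_iterate[OF sd] sub0 continuous_on_subset by blast
  fix c' d' assume cd': "c' \<in> closed_segment c d" "d' \<in> closed_segment c d"
    "(g ^^ N) c' \<le> (g ^^ N) d'"
    and ext': "\<And>w. w \<in> closed_segment c' d' \<Longrightarrow> (g ^^ N) c' \<le> (g ^^ N) w \<and> (g ^^ N) w \<le> (g ^^ N) d'"
  define I where "I = closed_segment c' d'"
  define F where "F = g ^^ N"
  define a where "a = F c'"
  define b where "b = F d'"
  have ext: "a \<le> F w" "F w \<le> b" if "w \<in> I" for w using ext' that unfolding I_def F_def a_def b_def by auto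
  have sub: "I \<subseteq> {0..e}" using sub0 cd' unfolding I_def
    by (meson subset_closed_segment subset_trans)
  have cI: "c' \<in> I" and dI: "d' \<in> I" unfolding I_def by auto
  have mem: "(g ^^ t) w \<in> {0..e}" if "w \<in> I" for t w
    using subdiagonal_iterate_mem[OF sd] sub that by blast
  have contI: "continuous_on I (g ^^ t)" for t
    using continuous_on_iterate[OF sd] sub continuous_on_subset by blast
  have step: "(g ^^ Suc t) w = g ((g ^^ t) w)" for t w by simp
  have split: "F w = (g ^^ (N - t)) ((g ^^ t) w)" if "t \<le> N" for t w
    using that unfolding F_def by (metis funpow_add o_apply le_add_diff_inverse2)
  have spl: "F w = (g ^^ Suc l) ((g ^^ t) w)" if "t + Suc l = N" for t l w
    using split[of t w] that by (metis add_diff_cancel_left' le_add1)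
  have ivt: "y \<in> (g ^^ t) ` I" if "u \<in> I" "v \<in> I" "(g ^^ t) u \<le> y" "y \<le> (g ^^ t) v" for t u v y
  proof -
    have "closed_segment u v \<subseteq> I" using that unfolding I_def by (simp add: subset_closed_segment)
    moreover have "y \<in> closed_segment ((g ^^ t) u) ((g ^^ t) v)"
      using that by (auto simp: closed_segment_eq_real_ivl)
    ultimately show ?thesis
      using IVT'_closed_segment_real[of y "g ^^ t" u v] contI continuous_on_subset by blast
  qed
  have seg: "(g ^^ t) c' \<in> (g ^^ t) ` I" "(g ^^ t) d' \<in> (g ^^ t) ` I" for t using cI dI by auto
  have F0: "0 \<le> F w" "F w \<le> e" if "w \<in> I" for w using mem[OF that, of N] unfolding F_def by auto
  \<comment> \<open>One \<delta> comes from the fold, another from the error of its two values. The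
    remaining cases only have to exhibit a time and two such points \<open>p\<close>,
    \<open>q\<close>.\<close>
  have via: "zigzag (3 * \<delta>) F c' d'"
    if h: "t + Suc l = N" "p \<in> (g ^^ t) ` I" "q \<in> (g ^^ t) ` I" "p \<in> {k'..k}" "q \<in> {k'..k}"
      "\<bar>(g ^^ Suc l) p - a\<bar> \<le> \<delta>" "\<bar>(g ^^ Suc l) q - b\<bar> \<le> \<delta>" for t l p q
  proof -
    have "zigzag (\<delta> + \<delta>) (\<lambda>y. (g ^^ Suc l) ((g ^^ t) y)) c' d'"
    proof (rule zigzag_via[where Q = "g ^^ t" and H = "g ^^ Suc l"])
      show "continuous_on (closed_segment c' d') (g ^^ t)" using contI unfolding I_def .
      show "p \<in> (g ^^ t) ` closed_segment c' d'" "q \<in> (g ^^ t) ` closed_segment c' d'"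
        using h unfolding I_def by auto
      show "zigzag \<delta> (g ^^ Suc l) p q" by (rule fold) (use h in auto)
      show "\<bar>(g ^^ Suc l) p - (g ^^ Suc l) ((g ^^ t) c')\<bar> \<le> \<delta>"
        "\<bar>(g ^^ Suc l) q - (g ^^ Suc l) ((g ^^ t) d')\<bar> \<le> \<delta>"
        using h(6,7) spl[OF h(1)] unfolding a_def b_def by auto
    qed
    then have "zigzag (2 * \<delta>) F c' d'" using spl[OF h(1)]
      by (simp add: zigzag_def del: funpow.simps)
    then show ?thesis by (rule zigzag_mono) (use pts in auto)
  qed
  have gkl: "(g ^^ Suc l) k = (g ^^ l) k'" for l by (simp add: funpow_swap1 gk)
  have gml: "(g ^^ Suc l) m = (g ^^ l) z" for l by (simp add: funpow_swap1 gm)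
  have val: "(g ^^ Suc l) p \<in> F ` I" if "t + Suc l = N" "p \<in> (g ^^ t) ` I" for t l p
    using that spl[OF that(1)] by auto
  define P where "P t \<longleftrightarrow> (\<exists>w\<in>I. k' \<le> (g ^^ t) w)" for t
  have up: "k \<le> (g ^^ t) w" if "w \<in> I" "k' \<le> (g ^^ Suc t) w" for t w
    using low[of "(g ^^ t) w"] that mem[of w t] by force
  have Pdown: "P s" if "P t" "s \<le> t" for s t
    using that subdiagonal_iterate_antimono[OF sd _ that(2)] sub unfolding P_def
    by (meson order_trans subset_iff)
  \<comment> \<open>Once the image is below \<open>k'\<close> with at least \<open>M\<close> steps
    left, it still is at time \<open>N - M\<close>, and the crookedness of \<open>g ^^ M\<close> on
    \<open>[0, k']\<close> is inherited.\<close>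
  have below: "zigzag (3 * \<delta>) F c' d'" if h: "t + l = N" "M \<le> l" "\<And>w. w \<in> I \<Longrightarrow> (g ^^ t) w \<le> k'" for t l
  proof -
    have e: "F = (\<lambda>w. (g ^^ M) ((g ^^ (N - M)) w))"
      using N unfolding F_def by (auto simp: fun_eq_iff) (metis funpow_add o_apply le_add_diff_inverse less_imp_le)
    have "(g ^^ (N - M)) w \<in> {0..k'}" if "w \<in> I" for w
    proof -
      have "t \<le> N - M" using h(1,2) by linarith
      then show ?thesis
        using subdiagonal_iterate_antimono[OF sd subsetD[OF sub that], of t "N - M"] h(3)[OF that]
          mem[OF that, of "N - M"] by auto
    qed
    then have "zigzag \<delta> (g ^^ M) ((g ^^ (N - M)) c') ((g ^^ (N - M)) d')"
      using crM cI dI by blast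
    then have "zigzag \<delta> F c' d'" unfolding e
      by (rule zigzag_lift[where Q = "g ^^ (N - M)" and H = "g ^^ M", rotated])
        (use contI in \<open>auto simp: I_def\<close>)
    then show ?thesis by (rule zigzag_mono) (use pts in auto)
  qed
  have "zigzag (3 * \<delta>) F c' d'"
  proof (cases "P 0")
    case False
    then show ?thesis using below[of 0 N] N unfolding P_def by (auto simp: not_le intro: less_imp_le)
  next
    case P0: True
    define t where "t = (GREATEST t. t \<le> N \<and> P t)"
    have t: "t \<le> N" "P t" and tmax: "\<And>s. s \<le> N \<Longrightarrow> P s \<Longrightarrow> s \<le> t"
      using GreatestI_nat[of "\<lambda>t. t \<le> N \<and> P t" 0 N] P0 Greatest_le_nat[of "\<lambda>t. t \<le> N \<and> P t" _ N]
      unfolding t_def by auto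
    \<comment> \<open>The split decides which value is under control. With at least \<open>i\<close>
      steps left after the fold, \<open>z\<close> has sunk below \<delta>. Otherwise the segment
      still meets \<open>[k', e]\<close> late enough to use the time \<open>r\<close> with exactly
      \<open>i\<close> steps left after the fold, where moreover \<open>k'\<close> stays above
      \<open>x\<close>.\<close>
    show ?thesis
    proof (cases "t + i < N")
      case True
      define l where "l = N - 1 - t"
      have l: "t + Suc l = N" "i \<le> l" using True unfolding l_def by auto
      have nP: "(g ^^ Suc t) w < k'" if "w \<in> I" for w
        using tmax[of "Suc t"] l(1) that unfolding P_def by force
      have tk: "(g ^^ t) w < k" if "w \<in> I" for w
        using high[of "(g ^^ t) w"] nP[OF that] mem[OF that, of t] by force
      show ?thesis
      proof (cases "M \<le> l")
        case True
        show ?thesis using below[of "Suc t" l] l True nP by (auto intro: less_imp_le)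
      next
        case lM: False
        show ?thesis
        proof (cases "\<forall>w\<in>I. k' \<le> (g ^^ t) w")
          case True
          show ?thesis
            by (rule via[OF l(1) seg]) (use True tk[OF cI] tk[OF dI] cI dI spl[OF l(1)] pts
                in \<open>auto simp: a_def b_def simp del: funpow.simps intro: less_imp_le\<close>)
        next
          case False
          then obtain y where y: "y \<in> I" "(g ^^ t) y \<le> k'" by force
          obtain y' where y': "y' \<in> I" "k' \<le> (g ^^ t) y'" using t(2) unfolding P_def by blast
          have kI: "k' \<in> (g ^^ t) ` I" using ivt y y' by blast
          have Fk: "(g ^^ Suc l) k' \<in> F ` I" using val l(1) kI by blast
          have bl: "b = (g ^^ Suc l) ((g ^^ t) d')" unfolding b_def using spl[OF l(1)] .
          have al: "a = (g ^^ Suc l) ((g ^^ t) c')" unfolding a_def using spl[OF l(1)] .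
          show ?thesis
          proof (cases "m \<le> (g ^^ t) d'")
            case True
            have mI: "m \<in> (g ^^ t) ` I" using ivt[of y d' t m] y True pts dI by auto
            then have "(g ^^ l) z \<in> F ` I" using val[OF l(1)] gml by metis
            then have "a \<le> (g ^^ l) z" "0 \<le> (g ^^ l) z" using ext F0 by auto
            then have "\<bar>(g ^^ Suc l) m - a\<bar> \<le> \<delta>" using bot[OF l(2)] gml[of l] F0(1)[OF cI] a_def by auto
            then show ?thesis
              by (intro via[OF l(1) mI seg(2)]) (use True tk[OF dI] bl pts in auto)
          next
            case False
            \<comment> \<open>Left of \<open>m\<close> the values are at most \<open>g k'\<close>,
              whose orbit dominates; hence \<open>k'\<close> itself realizes the maximum
              \<open>b\<close>.\<close>
            then have "g ((g ^^ t) d') \<le> g k'" using left mem[OF dI, of t] by auto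
            then have "(g ^^ l) (g ((g ^^ t) d')) \<le> (g ^^ l) (g k')"
              using rec' mem[OF dI, of "Suc t"] by auto
            then have "b \<le> (g ^^ Suc l) k'" unfolding bl by (simp add: funpow_swap1)
            then have b: "b = (g ^^ Suc l) k'" using Fk ext by force
            show ?thesis
            proof (cases "k' \<le> (g ^^ t) c'")
              case True
              show ?thesis
                by (rule via[OF l(1) seg(1) kI]) (use True tk[OF cI] b al pts in auto)
            next
              case ck: False
              \<comment> \<open>Now \<open>k'\<close> serves for \<open>b\<close>, but
                \<open>c'\<close> lies left of the fold. One step earlier the image contains
                \<open>k\<close>, which is mapped to \<open>k'\<close>, so the fold is used at time
                \<open>t - 1\<close> instead.\<close>
              have "t \<noteq> 0" using lM l N by auto
              then obtain s where s: "t = Suc s" using not0_implies_Suc by blast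
              have l': "s + Suc (Suc l) = N" using l s by simp
              have ys: "k \<le> (g ^^ s) y'" using up y' s by blast
              have cs: "(g ^^ s) c' < k"
                using high[of "(g ^^ s) c'"] ck mem[OF cI, of s] s by force
              have kI': "k \<in> (g ^^ s) ` I" using ivt[OF cI y'(1)] cs ys by auto
              have bk: "(g ^^ Suc (Suc l)) k = b" using gkl b by metis
              have al': "a = (g ^^ Suc (Suc l)) ((g ^^ s) c')" unfolding a_def using spl[OF l'] .
              show ?thesis
              proof (cases "k' \<le> (g ^^ s) c'")
                case True
                show ?thesis
                  by (rule via[OF l' seg(1) kI']) (use True cs bk al' pts in auto)
              next
                case False
                have mI: "m \<in> (g ^^ s) ` I" using ivt[OF cI y'(1), of s m] False ys pts by auto
                then have "(g ^^ Suc l) z \<in> F ` I" using val[OF l'] gml by metis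
                then have "a \<le> (g ^^ Suc l) z" "0 \<le> (g ^^ Suc l) z" using ext F0 by auto
                then have "\<bar>(g ^^ Suc (Suc l)) m - a\<bar> \<le> \<delta>"
                  using bot[of "Suc l"] l(2) gml[of "Suc l"] F0(1)[OF cI] a_def by auto
                then show ?thesis
                  by (intro via[OF l' mI kI']) (use bk pts in auto)
              qed
            qed
          qed
        qed
      qed
    next
      case False
      define r where "r = N - 1 - i"
      have r: "r + Suc i = N" using N unfolding r_def by auto
      have "P (Suc r)" using Pdown[OF t(2)] False r by auto
      then obtain y where y: "y \<in> I" "k' \<le> (g ^^ Suc r) y" unfolding P_def by blast
      have yk: "k \<le> (g ^^ r) y" using up y by blast
      \<comment> \<open>All values are at most \<open>e\<close>, so any value above \<open>x\<close>
        is within \<delta> of the maximum \<open>b\<close>.\<close>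
      have nearb: "\<bar>v - b\<bar> \<le> \<delta>" if "v \<in> F ` I" "x \<le> v" for v
      proof -
        have "v \<le> b" "b \<le> e" using that ext F0 dI b_def by auto
        then show ?thesis using that pts by auto
      qed
      show ?thesis
      proof (cases "\<exists>w\<in>I. (g ^^ r) w < k'")
        case True
        then obtain w where w: "w \<in> I" "(g ^^ r) w < k'" by blast
        have mI: "m \<in> (g ^^ r) ` I" and kI: "k \<in> (g ^^ r) ` I"
          using ivt[OF w(1) y(1), of r] w yk pts by auto
        have "(g ^^ i) z \<in> F ` I" using val[OF r mI] gml by metis
        then have "a \<le> (g ^^ i) z" "0 \<le> (g ^^ i) z" using ext F0 by auto
        then have A: "\<bar>(g ^^ Suc i) m - a\<bar> \<le> \<delta>" using bot[of i] gml[of i] F0(1)[OF cI] a_def by auto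
        have "\<bar>(g ^^ Suc i) k - b\<bar> \<le> \<delta>"
          using nearb[OF val[OF r kI]] top[of i] gkl[of i] by auto
        then show ?thesis using A by (intro via[OF r mI kI]) (use pts in auto)
      next
        case False
        then have rk: "k' \<le> (g ^^ r) w" if "w \<in> I" for w using that by force
        show ?thesis
        proof (cases "k' \<le> a")
          case True
          have "a \<le> b" "b \<le> e" using ext[OF cI] cI F0[OF dI] ext[OF dI] b_def by auto
          then have "\<bar>F c' - F d'\<bar> < 3 * \<delta>" using True pts a_def b_def by auto
          then show ?thesis by (rule zigzag_close)
        next
          case ak: False
          \<comment> \<open>At time \<open>r\<close> the whole image is at or above
            \<open>k'\<close>, possibly beyond \<open>k\<close>. The orbit of \<open>c'\<close> must
            still descend below \<open>k'\<close>, and the last time it is not below, it lies in the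
            fold. The partner is \<open>k\<close> or \<open>k'\<close>, which ends above
            \<open>x\<close>, or else the image of \<open>d'\<close>.\<close>
          define q where "q = (GREATEST q. q \<le> N \<and> k' \<le> (g ^^ q) c')"
          have q: "q \<le> N" "k' \<le> (g ^^ q) c'" and qmax: "\<And>s. s \<le> N \<Longrightarrow> k' \<le> (g ^^ s) c' \<Longrightarrow> s \<le> q"
            using GreatestI_nat[of "\<lambda>q. q \<le> N \<and> k' \<le> (g ^^ q) c'" r N] rk[OF cI] r
              Greatest_le_nat[of "\<lambda>q. q \<le> N \<and> k' \<le> (g ^^ q) c'" _ N]
            unfolding q_def by auto
          have rq: "r \<le> q" using qmax rk[OF cI] r by auto
          have "q \<noteq> N" using q ak unfolding a_def F_def by auto
          define l where "l = N - 1 - q"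
          have l: "q + Suc l = N" "l \<le> i" using \<open>q \<noteq> N\<close> q rq r unfolding l_def by auto
          have ck: "(g ^^ Suc q) c' < k'" using qmax[of "Suc q"] l by force
          then have cq: "(g ^^ q) c' < k" using high[of "(g ^^ q) c'"] mem[OF cI, of q] by force
          have al: "a = (g ^^ Suc l) ((g ^^ q) c')" unfolding a_def using spl[OF l(1)] .
          have bl: "b = (g ^^ Suc l) ((g ^^ q) d')" unfolding b_def using spl[OF l(1)] .
          show ?thesis
          proof (cases "\<exists>w\<in>I. k \<le> (g ^^ q) w")
            case True
            then have kI: "k \<in> (g ^^ q) ` I" using ivt[OF cI, of _ q k] cq by auto
            have "\<bar>(g ^^ Suc l) k - b\<bar> \<le> \<delta>"
              using nearb[OF val[OF l(1) kI]] top[of l] l gkl[of l] by auto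
            then show ?thesis by (intro via[OF l(1) seg(1) kI]) (use q cq al pts in auto)
          next
            case nk: False
            show ?thesis
            proof (cases "\<exists>w\<in>I. (g ^^ q) w < k'")
              case True
              then have kI: "k' \<in> (g ^^ q) ` I" using ivt[OF _ cI, of _ q k'] q by (auto intro: less_imp_le)
              have "r \<noteq> q" using True rk by force
              then have "Suc l \<le> i" using rq l r by auto
              then have "\<bar>(g ^^ Suc l) k' - b\<bar> \<le> \<delta>"
                using nearb[OF val[OF l(1) kI]] top by blast
              then show ?thesis by (intro via[OF l(1) seg(1) kI]) (use q cq al pts in auto)
            next
              case False
              then show ?thesis
                by (intro via[OF l(1) seg(1,2)]) (use q cq al bl pts nk dI in \<open>force+\<close>)
            qed
          qed
        qed
      qed
    qed
  qed
  then show "zigzag (3 * \<delta>) (g ^^ N) c' d'" unfolding F_def .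
qed

section \<open>Crookedness on initial intervals\<close>

definition crooked_on :: "real \<Rightarrow> (real \<Rightarrow> real) \<Rightarrow> bool" where
  "crooked_on x f \<longleftrightarrow> (\<forall>\<delta>>0. \<exists>n. \<forall>c\<in>{0..x}. \<forall>d\<in>{0..x}. zigzag \<delta> (f ^^ n) c d)"

lemma segment_subset_interval: "c \<in> {a..b} \<Longrightarrow> d \<in> {a..b} \<Longrightarrow> closed_segment c d \<subseteq> {a..b::real}"
  by (auto simp: closed_segment_eq_real_ivl split: if_splits)

lemma crooked_on_cong:
  assumes "subdiagonal x f" "crooked_on x f" "\<And>y. y \<in> {0..x} \<Longrightarrow> g y = f y"
  shows "crooked_on x g"
  unfolding crooked_on_def
proof (intro allI impI)
  fix \<delta> :: real assume "\<delta> > 0"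
  then obtain n where n: "\<And>c d. c \<in> {0..x} \<Longrightarrow> d \<in> {0..x} \<Longrightarrow> zigzag \<delta> (f ^^ n) c d"
    using assms(2) unfolding crooked_on_def by blast
  have "zigzag \<delta> (g ^^ n) c d" if "c \<in> {0..x}" "d \<in> {0..x}" for c d
    by (rule zigzag_cong[OF n[OF that]])
      (use iterate_cong[OF assms(1,3)] segment_subset_interval[OF that] in force)
  then show "\<exists>n. \<forall>c\<in>{0..x}. \<forall>d\<in>{0..x}. zigzag \<delta> (g ^^ n) c d" by blast
qed

lemma uniform_modulus:
  fixes F :: "real \<Rightarrow> real"
  assumes "continuous_on {0..x} F" "\<delta> > 0"
  obtains \<xi> where "\<xi> > 0" "\<And>y y'. y \<in> {0..x} \<Longrightarrow> y' \<in> {0..x} \<Longrightarrow> \<bar>y - y'\<bar> < \<xi> \<Longrightarrow> \<bar>F y - F y'\<bar> < \<delta>"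
proof -
  have "uniformly_continuous_on {0..x} F"
    using assms(1) by (intro compact_uniformly_continuous) auto
  from uniformly_continuous_onE[OF this assms(2)] obtain \<xi> where
    \<xi>: "\<xi> > 0" "\<And>y y'. y \<in> {0..x} \<Longrightarrow> y' \<in> {0..x} \<Longrightarrow> dist y' y < \<xi> \<Longrightarrow> dist (F y') (F y) < \<delta>"
    by blast
  show ?thesis
  proof (rule that[OF \<xi>(1)])
    fix y y' assume y: "y \<in> {0..x}" "y' \<in> {0..x}" "\<bar>y - y'\<bar> < \<xi>"
    then have "dist y y' < \<xi>" by (simp only: dist_real_def)
    from \<xi>(2)[OF y(2,1) this] show "\<bar>F y - F y'\<bar> < \<delta>" by (simp only: dist_real_def)
  qed
qed

text \<open>On the compact interval \<open>[x + \<xi>, k]\<close> the drop \<open>y - f y\<close>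
  has a positive minimum, so the number of steps can be chosen uniformly.\<close>

lemma iterate_below:
  assumes sd: "subdiagonal k f" and dec: "\<And>y. y \<in> {x<..k} \<Longrightarrow> f y < y" and "0 \<le> x" "\<xi> > 0"
  shows "\<exists>R. \<forall>y\<in>{0..k}. (f ^^ R) y \<le> x + \<xi>"
proof (cases "k \<le> x + \<xi>")
  case True
  then show ?thesis by (intro exI[of _ 0]) auto
next
  case False
  have "continuous_on {x + \<xi>..k} f"
    by (rule continuous_on_subset[of "{0..k}"]) (use sd assms(3,4) in \<open>auto simp: subdiagonal_def\<close>)
  then have "continuous_on {x + \<xi>..k} (\<lambda>y. y - f y)" by (intro continuous_intros)
  then have "\<exists>y0\<in>{x + \<xi>..k}. \<forall>y\<in>{x + \<xi>..k}. y0 - f y0 \<le> y - f y"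
    by (intro continuous_attains_inf) (use False in auto)
  then obtain y0 where y0: "y0 \<in> {x + \<xi>..k}" "\<And>y. y \<in> {x + \<xi>..k} \<Longrightarrow> y0 - f y0 \<le> y - f y" by blast
  define s where "s = y0 - f y0"
  have s: "s > 0" using dec[of y0] y0 assms unfolding s_def by auto
  have ind: "(f ^^ n) y \<le> max (x + \<xi>) (k - real n * s)" if "y \<in> {0..k}" for n y
  proof (induction n)
    case 0 then show ?case using that by auto
  next
    case (Suc n)
    have m: "(f ^^ n) y \<in> {0..k}" using subdiagonal_iterate_mem[OF sd that] .
    show ?case
    proof (cases "(f ^^ n) y \<le> x + \<xi>")
      case True
      have "f ((f ^^ n) y) \<le> (f ^^ n) y" using sd m unfolding subdiagonal_def by blast
      then show ?thesis using True by simp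
    next
      case False
      then have "s \<le> (f ^^ n) y - f ((f ^^ n) y)" using y0(2) m unfolding s_def by auto
      then show ?thesis using Suc False by (simp add: algebra_simps max_def split: if_splits)
    qed
  qed
  obtain R :: nat where "k < real R * s" using reals_Archimedean3[OF s] by blast
  then have "(f ^^ R) y \<le> x + \<xi>" if "y \<in> {0..k}" for y
    using ind[OF that, of R] assms(3,4) by (auto simp: max_def split: if_splits)
  then show ?thesis by blast
qed

text \<open>Beyond \<open>x\<close> all orbits fall back almost to \<open>[0, x]\<close>, and precomposition preserves crookedness.\<close>

lemma crooked_on_extend:
  assumes sd: "subdiagonal k f" and x: "0 \<le> x" "x \<le> k" and cr: "crooked_on x f"
    and dec: "\<And>y. y \<in> {x<..k} \<Longrightarrow> f y < y"
  shows "crooked_on k f"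
  unfolding crooked_on_def
proof (intro allI impI)
  fix \<delta> :: real assume \<delta>: "\<delta> > 0"
  then obtain M where M: "\<And>c d. c \<in> {0..x} \<Longrightarrow> d \<in> {0..x} \<Longrightarrow> zigzag (\<delta>/3) (f ^^ M) c d"
    using cr unfolding crooked_on_def by (metis divide_pos_pos zero_less_numeral)
  obtain \<xi> where \<xi>: "\<xi> > 0" "\<And>y y'. y \<in> {0..k} \<Longrightarrow> y' \<in> {0..k} \<Longrightarrow> \<bar>y - y'\<bar> < \<xi> \<Longrightarrow>
      \<bar>(f ^^ M) y - (f ^^ M) y'\<bar> < \<delta>/3"
    using uniform_modulus[OF continuous_on_iterate[OF sd, of M], of "\<delta>/3"] \<delta>
    by (metis divide_pos_pos zero_less_numeral)
  obtain R where R: "\<And>y. y \<in> {0..k} \<Longrightarrow> (f ^^ R) y \<le> x + \<xi>/2"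
    using iterate_below[OF sd dec x(1) half_gt_zero[OF \<xi>(1)]] by blast
  have A: "zigzag \<delta> (f ^^ M) c d" if cd: "c \<in> {0..k}" "d \<in> {0..k}" "c \<le> x + \<xi>/2" "d \<le> x + \<xi>/2" for c d
  proof -
    \<comment> \<open>\<open>min y x\<close> retracts onto \<open>[0, x]\<close>, where
      \<open>f ^^ M\<close> is crooked; points move by less than \<xi>, which costs twice
      \<delta>/3.\<close>
    have "zigzag (\<delta>/3) (\<lambda>y. (f ^^ M) (min y x)) c d"
      by (rule zigzag_lift[where Q = "\<lambda>y. min y x" and H = "f ^^ M"])
        (use cd x M in \<open>auto intro!: continuous_intros\<close>)
    then have "zigzag (\<delta>/3 + 2 * (\<delta>/3)) (f ^^ M) c d"
    proof (rule zigzag_approx)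
      fix y assume "y \<in> closed_segment c d"
      then have "y \<in> {0..min k (x + \<xi>/2)}"
        using segment_subset_interval[of c 0 "min k (x + \<xi>/2)" d] cd by auto
      then show "\<bar>(f ^^ M) (min y x) - (f ^^ M) y\<bar> \<le> \<delta>/3"
        using \<xi>(2)[of "min y x" y] x \<xi>(1) by (auto simp: min_def less_imp_le split: if_splits)
    qed
    then show ?thesis by simp
  qed
  have "zigzag \<delta> (f ^^ (M + R)) c d" if cd: "c \<in> {0..k}" "d \<in> {0..k}" for c d
  proof -
    have "zigzag \<delta> (\<lambda>y. (f ^^ M) ((f ^^ R) y)) c d"
    proof (rule zigzag_lift[where Q = "f ^^ R" and H = "f ^^ M"])
      show "continuous_on (closed_segment c d) (f ^^ R)"
        using continuous_on_iterate[OF sd] segment_subset_interval[OF cd] continuous_on_subset by blast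
      show "zigzag \<delta> (f ^^ M) ((f ^^ R) c) ((f ^^ R) d)"
        by (rule A) (use subdiagonal_iterate_mem[OF sd] R cd in blast)+
    qed
    then show ?thesis by (simp add: funpow_add o_def)
  qed
  then show "\<exists>n. \<forall>c\<in>{0..k}. \<forall>d\<in>{0..k}. zigzag \<delta> (f ^^ n) c d" by blast
qed

section \<open>Crooked sweeps with prescribed values\<close>

lemma zigzag_scale:
  assumes "zigzag \<delta> H u v" "s > 0"
  shows "zigzag (s * \<delta>) (\<lambda>y. r + s * H y) u v"
proof -
  have "\<bar>(r + s * H y) - (r + s * H y')\<bar> < s * \<delta> \<longleftrightarrow> \<bar>H y - H y'\<bar> < \<delta>" for y y'
  proof -
    have "\<bar>(r + s * H y) - (r + s * H y')\<bar> = s * \<bar>H y - H y'\<bar>"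
      using assms(2) by (simp add: abs_mult flip: right_diff_distrib)
    then show ?thesis using assms(2) by simp
  qed
  then show ?thesis using assms(1) unfolding zigzag_def by simp
qed

text \<open>Precomposition is free, but postcomposition uses up the modulus of continuity of the
  outer map; so the sweep is chosen after the iterates that follow it.\<close>

lemma zigzag_outer:
  assumes "zigzag \<zeta> K c d"
    and "\<And>u v. u \<in> closed_segment c d \<Longrightarrow> v \<in> closed_segment c d \<Longrightarrow> \<bar>K u - K v\<bar> < \<zeta> \<Longrightarrow>
      \<bar>H (K u) - H (K v)\<bar> < \<delta>"
  shows "zigzag \<delta> (\<lambda>y. H (K y)) c d"
proof -
  obtain c' d' where *: "c' \<in> closed_segment c d" "d' \<in> closed_segment c' d"
    "\<bar>K d - K c'\<bar> < \<zeta>" "\<bar>K c - K d'\<bar> < \<zeta>"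
    using assms(1) unfolding zigzag_def by blast
  have "d' \<in> closed_segment c d"
    using * by (auto simp: closed_segment_eq_real_ivl split: if_splits)
  then show ?thesis unfolding zigzag_def using * assms(2) by (intro bexI[of _ c'] bexI[of _ d']) auto
qed

text \<open>A crooked descent and a crooked ascent are joined at the lowest point. An extremal pair
  on both sides of it has minimal value \<open>lo\<close>, which the junction shares, so the pair
  can be moved into one half.\<close>

lemma crooked_sweep:
  fixes p q lo mid hi \<zeta> :: real
  assumes "p < q" "lo < mid" "mid < hi" "\<zeta> > 0"
  obtains \<kappa> where "continuous_on {p..q} \<kappa>" "\<kappa> p = mid" "\<kappa> ((p + q) / 2) = lo" "\<kappa> q = hi"
    "\<And>t. t \<in> {p..q} \<Longrightarrow> \<kappa> t \<in> {lo..hi}" "\<And>t. t \<in> {p..(p + q) / 2} \<Longrightarrow> \<kappa> t \<le> mid"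
    "\<And>t. t \<in> {p..<q} \<Longrightarrow> \<kappa> t < hi" "\<And>c d. c \<in> {p..q} \<Longrightarrow> d \<in> {p..q} \<Longrightarrow> zigzag \<zeta> \<kappa> c d"
proof -
  define m where "m = (p + q) / 2"
  have m: "p < m" "m < q" using assms unfolding m_def by auto
  \<comment> \<open>\<open>crook\<close> folds up to 2 of its \<open>n\<close> levels, each of
    height at most \<open>(hi - lo) / n\<close> after scaling. The \<open>max\<close> with 0 forces
    \<open>n > 0\<close>.\<close>
  obtain n :: nat where n: "n > 0" "2 * (hi - lo) < real n * \<zeta>"
    using reals_Archimedean3[OF assms(4), rule_format, of "max 0 (2 * (hi - lo))"]
    by (metis max_less_iff_conj mult_zero_left of_nat_0 of_nat_0_less_iff less_irrefl not_gr_zero)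
  define A where "A t = lo + (mid - lo) / n * crook n ((m - t) / (m - p))" for t
  define B where "B t = lo + (hi - lo) / n * crook n ((t - m) / (q - m))" for t
  define \<kappa> where "\<kappa> t = (if t \<le> m then A t else B t)" for t
  have arg: "(m - t) / (m - p) \<in> {0..1}" if "t \<in> {p..m}" for t using that m by auto
  have brg: "(t - m) / (q - m) \<in> {0..1}" if "t \<in> {m..q}" for t using that m by auto
  have brg': "(t - m) / (q - m) \<in> {0..<1}" if "t \<in> {m..<q}" for t using that m by auto
  have scale: "lo + (h - lo) / n * y \<in> {lo..h}" if "y \<in> {0..real n}" "lo < h" for y h
  proof -
    have "(h - lo) / n * y \<le> (h - lo) / n * n" using that n by (intro mult_left_mono) auto
    then show ?thesis using that n by auto
  qed
  have Ar: "A t \<in> {lo..mid}" if "t \<in> {p..m}" for t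
    unfolding A_def by (rule scale[OF crook_range[OF arg[OF that]] assms(2)])
  have Br: "B t \<in> {lo..hi}" if "t \<in> {m..q}" for t
    unfolding B_def by (rule scale[OF crook_range[OF brg[OF that]]]) (use assms in auto)
  have Br': "B t < hi" if "t \<in> {m..<q}" for t
  proof -
    have "(hi - lo) / n * crook n ((t - m) / (q - m)) < (hi - lo) / n * n"
      using n assms crook_less[OF n(1) brg'[OF that]] by (intro mult_strict_left_mono) auto
    then show ?thesis using n unfolding B_def by auto
  qed
  have Am: "A m = lo" "A p = mid" and Bm: "B m = lo" "B q = hi"
    using m n unfolding A_def B_def by auto
  have \<kappa>A: "\<kappa> t = A t" if "t \<in> {p..m}" for t using that unfolding \<kappa>_def by auto
  have \<kappa>B: "\<kappa> t = B t" if "t \<in> {m..q}" for t using that Am Bm unfolding \<kappa>_def by (cases "t = m") auto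
  have cA: "continuous_on {p..m} A" unfolding A_def
    by (intro continuous_intros continuous_on_compose2[OF continuous_on_crook]) (use arg m in auto)
  have cB: "continuous_on {m..q} B" unfolding B_def
    by (intro continuous_intros continuous_on_compose2[OF continuous_on_crook]) (use brg m in auto)
  have "continuous_on ({p..m} \<union> {m..q}) \<kappa>"
    by (intro continuous_on_closed_Un continuous_on_eq[OF cA] continuous_on_eq[OF cB])
      (use \<kappa>A \<kappa>B in auto)
  moreover have "{p..m} \<union> {m..q} = {p..q}" using m by auto
  ultimately have cont: "continuous_on {p..q} \<kappa>" by simp
  have zz: "zigzag \<zeta> (\<lambda>t. lo + (h - lo) / n * crook n (Q t)) u v"
    if "continuous_on (closed_segment u v) Q" "Q u \<in> {0..1}" "Q v \<in> {0..1}" "lo < h" "h \<le> hi" for Q u v h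
  proof -
    have "zigzag 2 (\<lambda>t. crook n (Q t)) u v"
      by (rule zigzag_lift[where H = "crook n" and Q = Q]) (use that zigzag_crook in auto)
    then have "zigzag ((h - lo) / n * 2) (\<lambda>t. lo + (h - lo) / n * crook n (Q t)) u v"
      by (rule zigzag_scale) (use that n in auto)
    moreover have "(h - lo) / n * 2 \<le> \<zeta>" using that n by (auto simp: field_simps)
    ultimately show ?thesis by (rule zigzag_mono)
  qed
  have zA: "zigzag \<zeta> \<kappa> u v" if "u \<in> {p..m}" "v \<in> {p..m}" for u v
  proof -
    have "zigzag \<zeta> A u v" unfolding A_def
      by (rule zz) (use arg that m assms in \<open>auto intro!: continuous_intros\<close>)
    then show ?thesis by (rule zigzag_cong) (use \<kappa>A segment_subset_interval[OF that] in auto)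
  qed
  have zB: "zigzag \<zeta> \<kappa> u v" if "u \<in> {m..q}" "v \<in> {m..q}" for u v
  proof -
    have "zigzag \<zeta> B u v" unfolding B_def
      by (rule zz) (use brg that m assms in \<open>auto intro!: continuous_intros\<close>)
    then show ?thesis by (rule zigzag_cong) (use \<kappa>B segment_subset_interval[OF that] in auto)
  qed
  have \<kappa>m: "\<kappa> m = lo" using \<kappa>A[of m] Am m by auto
  have lo: "lo \<le> \<kappa> t" if "t \<in> {p..q}" for t
    using that Ar[of t] Br[of t] \<kappa>A[of t] \<kappa>B[of t] by (cases "t \<le> m") auto
  have zz': "zigzag \<zeta> \<kappa> u v"
    if uv: "u \<in> {p..q}" "v \<in> {p..q}" "\<kappa> u \<le> \<kappa> v"
      and ext: "\<And>w. w \<in> closed_segment u v \<Longrightarrow> \<kappa> u \<le> \<kappa> w" for u v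
  proof -
    consider "u \<le> m" "v \<le> m" | "m \<le> u" "m \<le> v" | "u < m" "m < v" | "v < m" "m < u" by linarith
    then show ?thesis
    proof cases
      case 1 then show ?thesis using zA uv by auto
    next
      case 2 then show ?thesis using zB uv by auto
    next
      case 3
      have ms: "m \<in> closed_segment u v" using 3 by (auto simp: closed_segment_eq_real_ivl)
      then have "\<kappa> m = \<kappa> u" using ext[OF ms] lo[OF uv(1)] \<kappa>m by auto
      then show ?thesis using zigzag_sub[OF zB[of m v] ms ends_in_segment(2), of 0] 3 uv m by auto
    next
      case 4
      have ms: "m \<in> closed_segment u v" using 4 by (auto simp: closed_segment_eq_real_ivl)
      then have "\<kappa> m = \<kappa> u" using ext[OF ms] lo[OF uv(1)] \<kappa>m by auto
      then show ?thesis using zigzag_sub[OF zA[of m v] ms ends_in_segment(2), of 0] 4 uv m by auto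
    qed
  qed
  have "zigzag \<zeta> \<kappa> c d" if cd: "c \<in> {p..q}" "d \<in> {p..q}" for c d
  proof (rule zigzag_reduce)
    show "continuous_on (closed_segment c d) \<kappa>"
      using cont segment_subset_interval[OF cd] continuous_on_subset by blast
  qed (use zz' segment_subset_interval[OF cd] in blast)
  then show ?thesis
    using that[of \<kappa>] cont Am Bm \<kappa>A \<kappa>B \<kappa>m Ar Br Br' m unfolding m_def[symmetric]
    by (smt (verit) atLeastAtMost_iff atLeastLessThan_iff assms(3))
qed

subsection \<open>Adding a stage\<close>

text \<open>A partial construction on \<open>[0, x]\<close>: the orbit of the right end dominates all others,
  and \<open>z\<close> is a point through which later sweeps can be sent down to \<open>0\<close>.\<close>

definition stage :: "real \<Rightarrow> (real \<Rightarrow> real) \<Rightarrow> real \<Rightarrow> bool" where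
  "stage x f z \<longleftrightarrow> subdiagonal x f \<and> f x < x \<and> crooked_on x f \<and> z \<in> {0..x} \<and>
     (\<lambda>i. (f ^^ i) z) \<longlonglongrightarrow> 0 \<and> (\<forall>l. \<forall>w\<in>{0..x}. (f ^^ l) w \<le> (f ^^ l) x)"

lemma common_modulus:
  assumes "subdiagonal x f" "\<delta> > 0"
  shows "\<exists>\<xi>>0. \<forall>l\<le>n. \<forall>y\<in>{0..x}. \<forall>y'\<in>{0..x}. \<bar>y - y'\<bar> < \<xi> \<longrightarrow> \<bar>(f ^^ l) y - (f ^^ l) y'\<bar> < \<delta>"
proof (induction n)
  case 0
  show ?case using assms(2) by (intro exI[of _ \<delta>]) auto
next
  case (Suc n)
  then obtain \<xi>1 where 1: "\<xi>1 > 0" "\<And>l y y'. l \<le> n \<Longrightarrow> y \<in> {0..x} \<Longrightarrow> y' \<in> {0..x} \<Longrightarrow> \<bar>y - y'\<bar> < \<xi>1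
      \<Longrightarrow> \<bar>(f ^^ l) y - (f ^^ l) y'\<bar> < \<delta>" by blast
  obtain \<xi>2 where 2: "\<xi>2 > 0" "\<And>y y'. y \<in> {0..x} \<Longrightarrow> y' \<in> {0..x} \<Longrightarrow> \<bar>y - y'\<bar> < \<xi>2
      \<Longrightarrow> \<bar>(f ^^ Suc n) y - (f ^^ Suc n) y'\<bar> < \<delta>"
    using uniform_modulus[OF continuous_on_iterate[OF assms(1), of "Suc n"] assms(2)] by blast
  have "\<bar>(f ^^ l) y - (f ^^ l) y'\<bar> < \<delta>"
    if "l \<le> Suc n" "y \<in> {0..x}" "y' \<in> {0..x}" "\<bar>y - y'\<bar> < min \<xi>1 \<xi>2" for l y y'
  proof (cases "l = Suc n")
    case True
    then show ?thesis using 2(2)[of y y'] that by (simp del: funpow.simps)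
  next
    case False
    then show ?thesis using 1(2)[of l y y'] that by (simp del: funpow.simps)
  qed
  then show ?case using 1(1) 2(1) by (intro exI[of _ "min \<xi>1 \<xi>2"]) (auto simp del: funpow.simps)
qed

text \<open>The order of choices matters: \<open>z\<close> gives the time \<open>i\<close>, this the
  step \<theta> of the drift, the drift map \<open>h\<close> gives \<open>M\<close> and so
  \<open>N\<close>, the moduli of its iterates up to \<open>N\<close> give \<zeta>, and \<zeta>
  gives the sweep. Being fixed before the sweep, \<open>N\<close> is valid for every continuation
  \<open>g'\<close>. The new \<open>z\<close> is the bottom \<open>m\<close> of the sweep, which
  joins the old orbit in one step.\<close>

lemma stage_step:
  assumes st: "stage x f z" and k: "x < k'" "k' < k" "k \<le> e"
  obtains g m where "stage k g m" "k' \<le> m" "g k = k'" "\<And>y. y \<in> {0..x} \<Longrightarrow> g y = f y"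
    "\<And>y. y \<in> {x<..k} \<Longrightarrow> g y < y" "\<And>y. y \<in> {x..k} \<Longrightarrow> min z (f x) \<le> g y"
    "\<exists>N. \<forall>g'. subdiagonal e g' \<and> (\<forall>y\<in>{0..k}. g' y = g y) \<and> (\<forall>y\<in>{k..e}. k' \<le> g' y) \<longrightarrow>
      (\<forall>c\<in>{0..e}. \<forall>d\<in>{0..e}. zigzag (3 * (e - x)) (g' ^^ N) c d)"
proof -
  define \<delta> where "\<delta> = e - x"
  have \<delta>: "\<delta> > 0" using k unfolding \<delta>_def by auto
  have f: "subdiagonal x f" "f x < x" "crooked_on x f" and z: "z \<in> {0..x}" "(\<lambda>i. (f ^^ i) z) \<longlonglongrightarrow> 0"
    and recf: "\<And>l w. w \<in> {0..x} \<Longrightarrow> (f ^^ l) w \<le> (f ^^ l) x"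
    using st unfolding stage_def by auto
  have x0: "0 \<le> x" using z by auto
  have fr: "0 \<le> f y" "f y \<le> y" if "y \<in> {0..x}" for y using f(1) that unfolding subdiagonal_def by auto
  have fx0: "0 \<le> f x" "f x \<le> x" using fr x0 by auto
  have "eventually (\<lambda>l. (f ^^ l) z < \<delta>) sequentially" using z(2) \<delta> by (rule order_tendstoD(2))
  then obtain i where i: "\<And>l. i \<le> l \<Longrightarrow> (f ^^ l) z < \<delta>" unfolding eventually_sequentially by blast
  \<comment> \<open>After at most \<open>i\<close> steps of length \<theta> the point
    \<open>k' = x + q * \<theta>\<close> is still above \<open>x\<close>. Adding 2 ensures
    \<open>q > 1\<close> even for \<open>i = 0\<close>, so that \<open>k'\<close> lies beyond
    \<open>x + \<theta>\<close>.\<close>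
  define q where "q = i + 2"
  define \<theta> where "\<theta> = (k' - x) / real q"
  have \<theta>: "\<theta> > 0" "x + real q * \<theta> = k'" using k unfolding \<theta>_def q_def by auto
  have \<theta>2: "x + \<theta> < k'"
  proof -
    have "1 * \<theta> < real q * \<theta>" using \<theta>(1) unfolding q_def by (intro mult_strict_right_mono) auto
    then show ?thesis using \<theta>(2) by auto
  qed
  \<comment> \<open>Affine from \<open>f x\<close> at \<open>x\<close> to \<open>x\<close> at
    \<open>x + \<theta>\<close>, where the translation by -\<theta> takes over. It stays strictly
    below the diagonal because \<open>f x < x\<close>.\<close>
  define L where "L y = f x + (y - x) / \<theta> * (x - f x)" for y
  define h where "h y = (if y \<le> x then f y else if y \<le> x + \<theta> then L y else y - \<theta>)" for y
  have hf: "h y = f y" if "y \<le> x" for y using that unfolding h_def by auto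
  have Lx: "L x = f x" "L (x + \<theta>) = x" using \<theta> unfolding L_def by auto
  have hL: "h y = L y" if "y \<in> {x..x + \<theta>}" for y using that Lx unfolding h_def by (cases "y = x") auto
  have ht: "h y = y - \<theta>" if "x + \<theta> \<le> y" for y using that Lx \<theta> unfolding h_def by (cases "y = x + \<theta>") auto
  have Lmono: "L y \<le> L y'" if "y \<le> y'" for y y'
    unfolding L_def using that \<theta> f(2) by (intro add_left_mono mult_right_mono divide_right_mono) auto
  have Llt: "L y < y" if "y \<in> {x..x + \<theta>}" for y
  proof (cases "y = x")
    case True then show ?thesis using Lx f(2) by auto
  next
    case False
    then have "L y \<le> x" using Lmono[of y "x + \<theta>"] Lx that by auto
    then show ?thesis using False that by auto
  qed
  have hlt: "h y < y" if "x < y" for y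
  proof (cases "y \<le> x + \<theta>")
    case True then show ?thesis using hL[of y] Llt[of y] that by auto
  next
    case False then show ?thesis using ht[of y] \<theta> by auto
  qed
  have hge: "f x \<le> h y" if "x \<le> y" for y
  proof (cases "y \<le> x + \<theta>")
    case True then show ?thesis using hL[of y] Lmono[of x y] Lx that by auto
  next
    case False then show ?thesis using ht[of y] fx0 by auto
  qed
  have hmono: "h w \<le> h y" if "0 \<le> w" "w \<le> y" "x \<le> y" for w y
  proof -
    consider "w \<le> x" | "x < w" "y \<le> x + \<theta>" | "x < w" "w \<le> x + \<theta>" "x + \<theta> < y" | "x + \<theta> < w" by linarith
    then show ?thesis
    proof cases
      case 1
      then show ?thesis using recf[of w 1] hf hge that by fastforce
    next
      case 2 then show ?thesis using hL Lmono that by auto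
    next
      case 3
      then show ?thesis using hL[of w] Lmono[of w "x + \<theta>"] Lx ht[of y] by auto
    next
      case 4 then show ?thesis using ht that by auto
    qed
  qed
  have hch: "h (x + real (Suc j) * \<theta>) = x + real j * \<theta>" for j
  proof -
    have "0 \<le> real j * \<theta>" using \<theta> by simp
    then show ?thesis using ht[of "x + real (Suc j) * \<theta>"] \<theta> by (simp add: algebra_simps)
  qed
  have conth: "continuous_on {0..k'} h"
  proof -
    have "continuous_on (({0..x} \<union> {x..x + \<theta>}) \<union> {x + \<theta>..k'}) h"
    proof (intro continuous_on_closed_Un closed_Un closed_atLeastAtMost)
      show "continuous_on {0..x} h"
        using f(1) hf unfolding subdiagonal_def by (metis atLeastAtMost_iff continuous_on_eq)
      have "continuous_on {x..x + \<theta>} L" unfolding L_def using \<theta> by (intro continuous_intros) auto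
      then show "continuous_on {x..x + \<theta>} h" by (rule continuous_on_eq) (use hL in auto)
      have "continuous_on {x + \<theta>..k'} (\<lambda>y. y - \<theta>)" by (intro continuous_intros)
      then show "continuous_on {x + \<theta>..k'} h" by (rule continuous_on_eq) (use ht in auto)
    qed
    moreover have "({0..x} \<union> {x..x + \<theta>}) \<union> {x + \<theta>..k'} = {0..k'}" using x0 \<theta>(1) \<theta>2 by auto
    ultimately show ?thesis by simp
  qed
  have sdh: "subdiagonal k' h"
    unfolding subdiagonal_def
  proof (intro conjI ballI)
    fix y assume "y \<in> {0..k'}"
    then show "0 \<le> h y" "h y \<le> y"
      using hf[of y] fr[of y] hge[of y] hlt[of y] fx0 by (cases "y \<le> x"; force)+
  qed (rule conth)
  have sdhx: "(h ^^ l) w = (f ^^ l) w" if "w \<in> {0..x}" for l w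
    using iterate_cong[OF f(1), of h w l] hf that by auto
  \<comment> \<open>The points \<open>x + j * \<theta>\<close> are successive points of one orbit
    ending at \<open>x\<close>, and \<open>h\<close> dominates its values to the left of each; so
    domination climbs from \<open>x\<close> up to \<open>k'\<close>.\<close>
  have rech: "(h ^^ l) w \<le> (h ^^ l) (x + real j * \<theta>)" if "w \<in> {0..x + real j * \<theta>}" for l j w
    using that
  proof (induction j arbitrary: l w)
    case 0
    then show ?case using recf sdhx x0 by simp
  next
    case (Suc j)
    show ?case
    proof (cases l)
      case (Suc l')
      have j0: "0 \<le> real j * \<theta>" "0 \<le> real (Suc j) * \<theta>" using \<theta> by simp_all
      have "h w \<le> h (x + real (Suc j) * \<theta>)" using hmono Suc.prems j0 by auto
      then have "h w \<le> x + real j * \<theta>" using hch by simp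
      moreover have "0 \<le> h w" using hf[of w] fr[of w] hge[of w] fx0 Suc.prems by (cases "w \<le> x") auto
      ultimately have "(h ^^ l') (h w) \<le> (h ^^ l') (x + real j * \<theta>)" using Suc.IH by auto
      then show ?thesis using hch[of j] Suc by (simp add: funpow_swap1)
    qed (use Suc.prems in auto)
  qed
  have reck: "(h ^^ l) w \<le> (h ^^ l) k'" if "w \<in> {0..k'}" for l w using rech[of w q l] that \<theta>(2) by simp
  have hk': "h k' = x + real (q - 1) * \<theta>" using hch[of "q - 1"] \<theta>(2) unfolding q_def by simp
  have reck': "(h ^^ l) w \<le> (h ^^ l) (h k')" if "w \<in> {0..h k'}" for l w using rech[of w "q - 1" l] that hk' by simp
  have topj: "(h ^^ l) (x + real j * \<theta>) = x + real (j - l) * \<theta>" if "l \<le> j" for l j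
    using that
  proof (induction l)
    case (Suc l)
    then have "j - l = Suc (j - Suc l)" by auto
    then show ?case using Suc hch[of "j - Suc l"] by simp
  qed simp
  have toph: "x \<le> (h ^^ l) k'" if "l \<le> i" for l
    using topj[of l q] that \<theta> unfolding q_def by auto
  have crh: "crooked_on k' h"
  proof (rule crooked_on_extend[OF sdh x0])
    show "crooked_on x h" using crooked_on_cong[OF f(1,3)] hf by auto
  qed (use k hlt in auto)
  then obtain M where M: "\<And>c d. c \<in> {0..k'} \<Longrightarrow> d \<in> {0..k'} \<Longrightarrow> zigzag \<delta> (h ^^ M) c d"
    using \<delta> unfolding crooked_on_def by blast
  define N where "N = max M i + 1"
  obtain \<zeta> where \<zeta>: "\<zeta> > 0" "\<And>l y y'. l \<le> N \<Longrightarrow> y \<in> {0..k'} \<Longrightarrow> y' \<in> {0..k'} \<Longrightarrow> \<bar>y - y'\<bar> < \<zeta> \<Longrightarrow>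
      \<bar>(h ^^ l) y - (h ^^ l) y'\<bar> < \<delta>"
    using common_modulus[OF sdh \<delta>, of N] by blast
  have hkt: "h k' = k' - \<theta>" using ht[of k'] \<theta>2 by auto
  \<comment> \<open>The sweep starts at \<open>h k' = k' - \<theta>\<close> for continuity, touches
    \<open>z\<close>, and ends at \<open>k'\<close>, so that the continuation can stay at or above
    \<open>k'\<close>.\<close>
  have "z < k' - \<theta>" "k' - \<theta> < k'" using z \<theta>2 \<theta> by auto
  from crooked_sweep[OF k(2) this \<zeta>(1)] obtain \<kappa> where \<kappa>: "continuous_on {k'..k} \<kappa>" "\<kappa> k' = k' - \<theta>"
    "\<kappa> ((k' + k) / 2) = z" "\<kappa> k = k'" and \<kappa>r: "\<And>t. t \<in> {k'..k} \<Longrightarrow> \<kappa> t \<in> {z..k'}"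
    and \<kappa>l: "\<And>t. t \<in> {k'..(k' + k) / 2} \<Longrightarrow> \<kappa> t \<le> k' - \<theta>"
    and \<kappa>s: "\<And>t. t \<in> {k'..<k} \<Longrightarrow> \<kappa> t < k'"
    and \<kappa>z: "\<And>c d. c \<in> {k'..k} \<Longrightarrow> d \<in> {k'..k} \<Longrightarrow> zigzag \<zeta> \<kappa> c d" by blast
  define m where "m = (k' + k) / 2"
  have m: "k' < m" "m < k" using k unfolding m_def by auto
  define g where "g y = (if y \<le> k' then h y else \<kappa> y)" for y
  have gh: "g y = h y" if "y \<le> k'" for y using that unfolding g_def by auto
  have g\<kappa>: "g y = \<kappa> y" if "y \<in> {k'..k}" for y using that \<kappa>(2) hkt unfolding g_def by (cases "y = k'") auto
  have gf: "g y = f y" if "y \<in> {0..x}" for y using gh hf that k by auto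
  have glt: "g y < y" if "y \<in> {x<..k}" for y
  proof (cases "y \<le> k'")
    case True then show ?thesis using gh hlt that by auto
  next
    case False then show ?thesis using g\<kappa>[of y] \<kappa>r[of y] that by auto
  qed
  have ghr: "min z (f x) \<le> g y" if "y \<in> {x..k}" for y
  proof (cases "y \<le> k'")
    case True then show ?thesis using gh hge[of y] that by auto
  next
    case False then show ?thesis using g\<kappa>[of y] \<kappa>r[of y] that by auto
  qed
  have gk: "g k = k'" using g\<kappa>[of k] \<kappa> k by auto
  have gm: "g m = z" using g\<kappa>[of m] \<kappa> m unfolding m_def by auto
  have sdg: "subdiagonal k g"
    unfolding subdiagonal_def
  proof (intro conjI ballI)
    have "continuous_on ({0..k'} \<union> {k'..k}) g"
      by (intro continuous_on_closed_Un continuous_on_eq[OF conth] continuous_on_eq[OF \<kappa>(1)])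
        (use gh g\<kappa> in auto)
    moreover have "{0..k'} \<union> {k'..k} = {0..k}" using x0 k by auto
    ultimately show "continuous_on {0..k} g" by simp
  next
    fix y assume "y \<in> {0..k}"
    then show "0 \<le> g y" "g y \<le> y"
      using gf[of y] fr[of y] ghr[of y] glt[of y] fx0 z(1) by (cases "y \<le> x"; force)+
  qed
  have ext_h: "(g' ^^ l) w = (h ^^ l) w" if "\<And>y. y \<in> {0..k} \<Longrightarrow> g' y = g y" "w \<in> {0..k'}" for g' l w
    using iterate_cong[OF sdh, of g' w l] gh that k by auto
  have crg: "crooked_on k g"
  proof (rule crooked_on_extend[OF sdg x0])
    show "crooked_on x g" using crooked_on_cong[OF f(1,3)] gf by auto
  qed (use k glt in auto)
  have gk': "g w \<le> k'" if "w \<in> {0..k}" for w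
  proof (cases "w \<le> k'")
    case True then show ?thesis using sdg that unfolding subdiagonal_def by force
  next
    case False then show ?thesis using g\<kappa>[of w] \<kappa>r[of w] that by auto
  qed
  have "stage k g m"
    unfolding stage_def
  proof (intro conjI allI ballI)
    have "(g ^^ Suc l) m = (f ^^ l) z" for l
      using iterate_cong[OF f(1), of g z l] gf z(1) gm by (simp add: funpow_swap1)
    then have "(\<lambda>l. (g ^^ Suc l) m) \<longlonglongrightarrow> 0" using z(2) by (simp del: funpow.simps)
    then show "(\<lambda>l. (g ^^ l) m) \<longlonglongrightarrow> 0" by (rule LIMSEQ_imp_Suc)
    fix l w assume w: "w \<in> {0..k}"
    show "(g ^^ l) w \<le> (g ^^ l) k"
    proof (cases l)
      case (Suc l')
      \<comment> \<open>\<open>g\<close> maps \<open>[0, k]\<close> below \<open>k'\<close> and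
        \<open>k\<close> to \<open>k'\<close>, which reduces domination by \<open>k\<close> to that
        by \<open>k'\<close>.\<close>
      have "(h ^^ l') (g w) \<le> (h ^^ l') k'"
        using reck gk'[OF w] w sdg unfolding subdiagonal_def by auto
      moreover have "g w \<in> {0..k'}" "k' \<in> {0..k'}"
        using gk'[OF w] w sdg x0 k unfolding subdiagonal_def by auto
      ultimately show ?thesis using ext_h[of g _ l'] gk Suc by (simp add: funpow_swap1)
    qed (use w in auto)
  qed (use sdg gk k crg m x0 in auto)
  moreover have "zigzag (3 * (e - x)) (g' ^^ N) c d"
    if sdg': "subdiagonal e g'" and g': "\<And>y. y \<in> {0..k} \<Longrightarrow> g' y = g y" "\<And>y. y \<in> {k..e} \<Longrightarrow> k' \<le> g' y"
      and cd: "c \<in> {0..e}" "d \<in> {0..e}" for g' c d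
    unfolding \<delta>_def[symmetric]
  proof (rule zigzag_iterate[OF sdg', where x = x and k' = k' and m = m and k = k and i = i and M = M and z = z])
    have k'k: "k' \<in> {0..k'}" using x0 k by auto
    have g'k': "g' k' = h k'" using g'(1)[of k'] gh[of k'] x0 k by auto
    have hk0: "h k' \<in> {0..k'}" using sdh k'k unfolding subdiagonal_def by auto
    show "g' w < k'" if "w \<in> {0..<k}" for w
    proof (cases "w < k'")
      case True
      then show ?thesis using sdg that g'(1)[of w] unfolding subdiagonal_def by force
    next
      case False then show ?thesis using g\<kappa>[of w] \<kappa>s[of w] g'(1)[of w] that by auto
    qed
    show "g' m = z" "g' k = k'" using g'(1) gm gk m k x0 by auto
    show "g' w \<le> g' k'" if "w \<in> {0..m}" for w
    proof (cases "w \<le> k'")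
      case True
      then show ?thesis using reck[of w 1] that g'(1)[of w] g'k' gh[of w] m by auto
    next
      case False
      then show ?thesis using g\<kappa>[of w] \<kappa>l[of w] g'(1)[of w] that g'k' hkt m unfolding m_def by auto
    qed
    show "(g' ^^ l) w \<le> (g' ^^ l) k'" if "w \<in> {0..k'}" for l w
      using reck[OF that] ext_h[OF g'(1)] that k'k by simp
    show "(g' ^^ l) w \<le> (g' ^^ l) (g' k')" if "w \<in> {0..g' k'}" for l w
      using reck'[of w l] ext_h[OF g'(1)] that hk0 g'k' by auto
    show "x \<le> (g' ^^ l) k'" if "l \<le> i" for l using toph[OF that] ext_h[OF g'(1)] k'k by simp
    show "(g' ^^ l) z \<le> \<delta>" if "i \<le> l" for l
      using i[OF that] ext_h[OF g'(1), of z l] sdhx[of z l] z(1) k by auto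
    show "zigzag \<delta> (g' ^^ M) c d" if "c \<in> {0..k'}" "d \<in> {0..k'}" for c d
      by (rule zigzag_cong[OF M[OF that]])
        (use ext_h[OF g'(1)] segment_subset_interval[OF that] in force)
    show "zigzag \<delta> (g' ^^ Suc l) c d" if l: "l \<le> N" and "c \<in> {k'..k}" "d \<in> {k'..k}" for l c d
    proof -
      have sub: "closed_segment c d \<subseteq> {k'..k}" using that by (intro segment_subset_interval)
      have \<kappa>0: "\<kappa> y \<in> {0..k'}" if "y \<in> {k'..k}" for y using \<kappa>r[OF that] z(1) by auto
      have "zigzag \<delta> (\<lambda>y. (h ^^ l) (\<kappa> y)) c d"
        by (rule zigzag_outer[OF \<kappa>z[OF that(2,3)]]) (use \<zeta>(2)[OF l] \<kappa>0 sub in blast)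
      then show ?thesis
      proof (rule zigzag_cong)
        fix y assume "y \<in> closed_segment c d"
        then have y: "y \<in> {k'..k}" using sub by blast
        then have "g' y = \<kappa> y" using g'(1)[of y] g\<kappa>[of y] k x0 by auto
        then show "(h ^^ l) (\<kappa> y) = (g' ^^ Suc l) y"
          using ext_h[OF g'(1) \<kappa>0[OF y]] by (simp add: funpow_swap1)
      qed
    qed
  qed (use k m x0 \<delta> g' cd in \<open>auto simp: \<delta>_def N_def\<close>)
  then have "\<exists>N. \<forall>g'. subdiagonal e g' \<and> (\<forall>y\<in>{0..k}. g' y = g y) \<and> (\<forall>y\<in>{k..e}. k' \<le> g' y) \<longrightarrow>
      (\<forall>c\<in>{0..e}. \<forall>d\<in>{0..e}. zigzag (3 * (e - x)) (g' ^^ N) c d)" by blast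
  ultimately show ?thesis using that[of g m] m gk gf glt ghr by auto
qed

subsection \<open>Adding a fixed point\<close>

text \<open>At \<open>e\<close>, continuity holds because \<open>f y\<close> is squeezed between
  \<open>b n\<close> and \<open>y\<close>. The bounds persist in the limit, which makes it an
  admissible continuation of every partial map.\<close>

lemma glue:
  fixes x b :: "nat \<Rightarrow> real" and F :: "nat \<Rightarrow> real \<Rightarrow> real"
  assumes x: "strict_mono x" "x \<longlonglongrightarrow> e" "0 \<le> x 0"
    and sd: "\<And>n. subdiagonal (x n) (F n)"
    and ext: "\<And>n y. y \<in> {0..x n} \<Longrightarrow> F (Suc n) y = F n y"
    and b: "incseq b" "b \<longlonglongrightarrow> e" "\<And>n y. y \<in> {x n..x (Suc n)} \<Longrightarrow> b n \<le> F (Suc n) y"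
  obtains f where "subdiagonal e f" "f e = e" "\<And>n y. y \<in> {0..x n} \<Longrightarrow> f y = F n y"
    "\<And>n y. y \<in> {x n..e} \<Longrightarrow> b n \<le> f y"
proof -
  have xi: "incseq x" using x(1) by (simp add: strict_mono_mono)
  have xe: "x n < e" for n
    using incseq_le[OF xi x(2), of "Suc n"] strict_monoD[OF x(1), of n "Suc n"] by simp
  have be: "b n \<le> e" for n using incseq_le[OF b(1,2)] .
  have x0: "0 \<le> x n" for n using x(3) incseqD[OF xi, of 0 n] by simp
  have near: "\<exists>n. y < x n" if "y < e" for y
    using order_tendstoD(1)[OF x(2) that] unfolding eventually_sequentially by blast
  have Fm: "F m y = F n y" if "n \<le> m" "y \<in> {0..x n}" for m n y
    using that(1)
  proof (induction m rule: dec_induct)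
    case (step m)
    then show ?case using ext[of y m] incseqD[OF xi step(1)] that(2) by auto
  qed simp
  \<comment> \<open>Any index with \<open>y \<le> x n\<close> gives the same value; the least is a
    canonical choice. The value from \<open>e\<close> on makes \<open>e\<close> a fixed
    point.\<close>
  define f where "f y = (if y < e then F (LEAST n. y \<le> x n) y else e)" for y
  have fF: "f y = F n y" if "y \<in> {0..x n}" for n y
  proof -
    have "(LEAST n. y \<le> x n) \<le> n" "y \<le> x (LEAST n. y \<le> x n)"
      using that by (auto intro: Least_le LeastI)
    then show ?thesis using Fm[of "LEAST n. y \<le> x n" n y] that xe[of n] unfolding f_def by auto
  qed
  have fe: "f e = e" unfolding f_def by simp
  have lower: "b n \<le> f y" if y: "y \<in> {x n..e}" for n y
  proof (cases "y < e")
    case True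
    then obtain m0 where m0: "y \<le> x m0" using near less_imp_le by blast
    define m where "m = (LEAST m. y \<le> x m)"
    have m: "y \<le> x m" unfolding m_def using m0 by (rule LeastI)
    have ml: "x j < y" if "j < m" for j using not_less_Least[of j "\<lambda>m. y \<le> x m"] that unfolding m_def by auto
    have y0: "0 \<le> y" using y x0[of n] by auto
    show ?thesis
    proof (cases "m \<le> n")
      case True
      then have "y = x n" using y m incseqD[OF xi True] by auto
      then show ?thesis using b(3)[of y n] fF[of y "Suc n"] incseqD[OF xi, of n "Suc n"] y0 by auto
    next
      case False
      then obtain j where j: "m = Suc j" "n \<le> j" by (metis Suc_le_mono not_less_eq_eq old.nat.exhaust zero_le)
      have "b j \<le> F (Suc j) y" using b(3)[of y j] ml[of j] m j by auto
      then show ?thesis using incseqD[OF b(1) j(2)] fF[of y m] m y0 j by auto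
    qed
  next
    case False then show ?thesis using y fe be[of n] by auto
  qed
  have le: "0 \<le> f y \<and> f y \<le> y" if "y \<in> {0..e}" for y
  proof (cases "y < e")
    case True
    then obtain n where "y < x n" using near by blast
    then have "y \<in> {0..x n}" using that by auto
    then show ?thesis using fF[of y n] sd[of n] unfolding subdiagonal_def by auto
  next
    case False then show ?thesis using that fe by auto
  qed
  have "continuous (at y within {0..e}) f" if y: "y \<in> {0..e}" for y
  proof (cases "y < e")
    case True
    then obtain n where n: "y < x n" using near by blast
    have "continuous_on {0..x n} f"
      using sd[of n] fF unfolding subdiagonal_def by (metis continuous_on_eq)
    then have "continuous (at y within {0..x n}) f"
      using n y by (simp add: continuous_on_eq_continuous_within)
    moreover have "at y within {0..x n} = at y within {0..e}"
      by (rule at_within_nhd[of _ "{..<x n}"]) (use n xe[of n] in auto)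
    ultimately show ?thesis by simp
  next
    case False
    then have ye: "y = e" using y by auto
    show ?thesis unfolding ye continuous_within_eps_delta
    proof (intro allI impI)
      fix \<epsilon> :: real assume "\<epsilon> > 0"
      then have "eventually (\<lambda>n. e - \<epsilon> < b n) sequentially"
        by (intro order_tendstoD(1)[OF b(2)]) auto
      then obtain n where n: "e - \<epsilon> < b n" unfolding eventually_sequentially by blast
      have "dist (f t) (f e) < \<epsilon>" if "t \<in> {0..e}" "dist t e < e - x n" for t
        using lower[of t n] le[OF that(1)] that n fe by (auto simp: dist_real_def)
      then show "\<exists>d>0. \<forall>t\<in>{0..e}. dist t e < d \<longrightarrow> dist (f t) (f e) < \<epsilon>"
        using xe[of n] by (intro exI[of _ "e - x n"]) auto
    qed
  qed
  then have "continuous_on {0..e} f" by (simp add: continuous_on_eq_continuous_within)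
  then have "subdiagonal e f" unfolding subdiagonal_def using le by blast
  then show ?thesis using that fe fF lower by blast
qed

text \<open>The last clause supplies the \<open>z\<close> of the next stage arbitrarily close to
  \<open>p\<close>. Since later sweeps reach down to it, this keeps the continuation close to
  \<open>p\<close>.\<close>

definition good :: "real \<Rightarrow> (real \<Rightarrow> real) \<Rightarrow> bool" where
  "good p f \<longleftrightarrow> 0 \<le> p \<and> subdiagonal p f \<and> f p = p \<and> crooked_on p f \<and>
     (\<forall>\<eta>>0. \<exists>w\<in>{0..p}. p - \<eta> < w \<and> (\<lambda>i. (f ^^ i) w) \<longlonglongrightarrow> 0)"

lemma stage_limit:
  assumes st: "stage x f z" and e: "x < e"
  obtains g where "good e g" "\<And>y. y \<in> {0..x} \<Longrightarrow> g y = f y" "\<And>y. y \<in> {x<..<e} \<Longrightarrow> g y < y"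
    "\<And>y. y \<in> {x..e} \<Longrightarrow> min z (f x) \<le> g y"
proof -
  have x0: "0 \<le> x" using st unfolding stage_def by auto
  \<comment> \<open>Each stage covers half of the remaining distance to \<open>e\<close>, so the
    bound \<open>3 * (e - X n)\<close> tends to 0.\<close>
  define X where "X n = e - (e - x) / 2 ^ n" for n :: nat
  define K where "K n = (X n + X (Suc n)) / 2" for n
  have X0: "X 0 = x" unfolding X_def by simp
  have Xs: "X n < X (Suc n)" "X n < e" for n using e unfolding X_def by (auto simp: field_simps)
  have K: "X n < K n" "K n < X (Suc n)" for n using Xs[of n] unfolding K_def by auto
  have smX: "strict_mono X" using Xs by (simp add: strict_mono_Suc_iff)
  have "(\<lambda>n. (e - x) * (1 / 2) ^ n) \<longlonglongrightarrow> (e - x) * 0"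
    by (intro tendsto_mult_left LIMSEQ_power_zero) auto
  then have gap: "(\<lambda>n. (e - x) / 2 ^ n) \<longlonglongrightarrow> 0" by (simp add: power_one_over)
  have "(\<lambda>n. e - (e - x) / 2 ^ n) \<longlonglongrightarrow> e - 0" by (intro tendsto_diff tendsto_const gap)
  then have Xl: "X \<longlonglongrightarrow> e" unfolding X_def by simp
  have "(\<lambda>n. (X n + X (Suc n)) / 2) \<longlonglongrightarrow> (e + e) / 2"
    by (intro tendsto_divide tendsto_add Xl LIMSEQ_Suc[OF Xl] tendsto_const) auto
  then have Kl: "K \<longlonglongrightarrow> e" unfolding K_def by simp
  \<comment> \<open>The clause for \<open>n = 0\<close> pins the chosen sequence to the given
    stage.\<close>
  define P where "P n s \<longleftrightarrow> stage (X n) (fst s) (snd s) \<and> (n = 0 \<longrightarrow> s = (f, z))" for n and s :: "(real \<Rightarrow> real) \<times> real"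
  define Q where "Q n s s' \<longleftrightarrow> K n \<le> snd s' \<and> fst s' (X (Suc n)) = K n \<and>
      (\<forall>y\<in>{0..X n}. fst s' y = fst s y) \<and> (\<forall>y\<in>{X n<..X (Suc n)}. fst s' y < y) \<and>
      (\<forall>y\<in>{X n..X (Suc n)}. min (snd s) (fst s (X n)) \<le> fst s' y) \<and>
      (\<exists>N. \<forall>g'. subdiagonal e g' \<and> (\<forall>y\<in>{0..X (Suc n)}. g' y = fst s' y) \<and> (\<forall>y\<in>{X (Suc n)..e}. K n \<le> g' y) \<longrightarrow>
      (\<forall>c\<in>{0..e}. \<forall>d\<in>{0..e}. zigzag (3 * (e - X n)) (g' ^^ N) c d))"
    for n and s s' :: "(real \<Rightarrow> real) \<times> real"
  have "\<exists>S. \<forall>n. P n (S n) \<and> Q n (S n) (S (Suc n))"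
  proof (rule dependent_nat_choice)
    show "\<exists>s. P 0 s" using st X0 unfolding P_def by (intro exI[of _ "(f, z)"]) auto
    fix s n assume "P n s"
    then have "stage (X n) (fst s) (snd s)" unfolding P_def by blast
    then show "\<exists>s'. P (Suc n) s' \<and> Q n s s'"
    proof (rule stage_step[OF _ K(1)[of n] K(2)[of n] less_imp_le[OF Xs(2)[of "Suc n"]]])
      fix g m
      assume a: "stage (X (Suc n)) g m" "K n \<le> m" "g (X (Suc n)) = K n"
        "\<And>y. y \<in> {0..X n} \<Longrightarrow> g y = fst s y" "\<And>y. y \<in> {X n<..X (Suc n)} \<Longrightarrow> g y < y"
        "\<And>y. y \<in> {X n..X (Suc n)} \<Longrightarrow> min (snd s) (fst s (X n)) \<le> g y"
        "\<exists>N. \<forall>g'. subdiagonal e g' \<and> (\<forall>y\<in>{0..X (Suc n)}. g' y = g y) \<and> (\<forall>y\<in>{X (Suc n)..e}. K n \<le> g' y) \<longrightarrow>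
          (\<forall>c\<in>{0..e}. \<forall>d\<in>{0..e}. zigzag (3 * (e - X n)) (g' ^^ N) c d)"
      have "P (Suc n) (g, m)" unfolding P_def using a(1) by simp
      moreover have "Q n s (g, m)" unfolding Q_def fst_conv snd_conv
        by (intro conjI ballI a(2-7))
      ultimately show ?thesis by blast
    qed
  qed
  then obtain S where S: "\<And>n. P n (S n)" "\<And>n. Q n (S n) (S (Suc n))" by blast
  define F where "F n = fst (S n)" for n
  define Z where "Z n = snd (S n)" for n
  have stn: "stage (X n) (F n) (Z n)" for n using S(1) unfolding P_def F_def Z_def by blast
  have F0: "F 0 = f" "Z 0 = z" using S(1)[of 0] unfolding P_def F_def Z_def by auto
  have KZ: "K n \<le> Z (Suc n)" and FX: "F (Suc n) (X (Suc n)) = K n"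
    and Fext: "\<And>y. y \<in> {0..X n} \<Longrightarrow> F (Suc n) y = F n y"
    and Flt: "\<And>y. y \<in> {X n<..X (Suc n)} \<Longrightarrow> F (Suc n) y < y"
    and Fge: "\<And>y. y \<in> {X n..X (Suc n)} \<Longrightarrow> min (Z n) (F n (X n)) \<le> F (Suc n) y"
    and Fcr: "\<exists>N. \<forall>g'. subdiagonal e g' \<and> (\<forall>y\<in>{0..X (Suc n)}. g' y = F (Suc n) y) \<and> (\<forall>y\<in>{X (Suc n)..e}. K n \<le> g' y) \<longrightarrow>
      (\<forall>c\<in>{0..e}. \<forall>d\<in>{0..e}. zigzag (3 * (e - X n)) (g' ^^ N) c d)" for n
    using S(2)[of n] unfolding Q_def F_def Z_def by blast+
  have Fsd: "subdiagonal (X n) (F n)" for n using stn unfolding stage_def by blast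
  \<comment> \<open>A stage takes no values below the old \<open>z\<close> and the old end value,
    and from the second stage on both are at least the preceding \<open>K j\<close>.\<close>
  define b where "b n = (case n of 0 \<Rightarrow> min z (f x) | Suc j \<Rightarrow> K j)" for n
  have bmin: "b n \<le> min (Z n) (F n (X n))" for n
    using F0 X0 KZ FX unfolding b_def by (cases n) auto
  have "b n \<le> b (Suc n)" for n
  proof (cases n)
    case 0
    then show ?thesis using st K(1)[of 0] X0 unfolding b_def stage_def by auto
  next
    case (Suc j)
    then show ?thesis using K(2)[of j] K(1)[of n] unfolding b_def by auto
  qed
  then have b1: "incseq b" by (simp add: incseq_Suc_iff)
  have "(\<lambda>n. b (Suc n)) \<longlonglongrightarrow> e" using Kl unfolding b_def by simp
  then have b2: "b \<longlonglongrightarrow> e" by (rule LIMSEQ_imp_Suc)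
  obtain g where g: "subdiagonal e g" "g e = e" "\<And>n y. y \<in> {0..X n} \<Longrightarrow> g y = F n y"
    "\<And>n y. y \<in> {X n..e} \<Longrightarrow> b n \<le> g y"
  proof (rule glue[OF smX Xl _ Fsd Fext b1 b2])
    show "0 \<le> X 0" using X0 x0 by simp
    show "b n \<le> F (Suc n) y" if "y \<in> {X n..X (Suc n)}" for n y using Fge[OF that] bmin[of n] by linarith
  qed auto
  have Xn0: "0 \<le> X n" for n using X0 x0 strict_mono_less_eq[OF smX, of 0 n] by simp
  have "crooked_on e g" unfolding crooked_on_def
  proof (intro allI impI)
    fix \<delta> :: real assume "\<delta> > 0"
    then have "eventually (\<lambda>n. (e - x) / 2 ^ n < \<delta> / 3) sequentially" by (intro order_tendstoD(2)[OF gap]) auto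
    then obtain n where n: "(e - x) / 2 ^ n < \<delta> / 3" unfolding eventually_sequentially by blast
    have "e - X n = (e - x) / 2 ^ n" unfolding X_def by simp
    then have "e - X n < \<delta> / 3" using n by (simp only:)
    then have n': "3 * (e - X n) \<le> \<delta>" by (simp add: field_simps)
    obtain N where N: "\<And>g'. subdiagonal e g' \<Longrightarrow> (\<forall>y\<in>{0..X (Suc n)}. g' y = F (Suc n) y) \<Longrightarrow> (\<forall>y\<in>{X (Suc n)..e}. K n \<le> g' y) \<Longrightarrow>
      (\<forall>c\<in>{0..e}. \<forall>d\<in>{0..e}. zigzag (3 * (e - X n)) (g' ^^ N) c d)" using Fcr[of n] by blast
    have "\<forall>c\<in>{0..e}. \<forall>d\<in>{0..e}. zigzag (3 * (e - X n)) (g ^^ N) c d"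
    proof (rule N[OF g(1)])
      show "\<forall>y\<in>{0..X (Suc n)}. g y = F (Suc n) y" using g(3) by blast
      show "\<forall>y\<in>{X (Suc n)..e}. K n \<le> g y" using g(4)[of _ "Suc n"] unfolding b_def by auto
    qed
    then show "\<exists>N. \<forall>c\<in>{0..e}. \<forall>d\<in>{0..e}. zigzag \<delta> (g ^^ N) c d" using zigzag_mono[OF _ n'] by blast
  qed
  moreover have "\<exists>w\<in>{0..e}. e - \<eta> < w \<and> (\<lambda>i. (g ^^ i) w) \<longlonglongrightarrow> 0" if "\<eta> > 0" for \<eta>
  proof -
    have "eventually (\<lambda>n. e - \<eta> < K n) sequentially" using that by (intro order_tendstoD(1)[OF Kl]) auto
    then obtain n where n: "e - \<eta> < K n" unfolding eventually_sequentially by blast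
    have Z: "Z (Suc n) \<in> {0..X (Suc n)}" "(\<lambda>i. (F (Suc n) ^^ i) (Z (Suc n))) \<longlonglongrightarrow> 0"
      using stn[of "Suc n"] unfolding stage_def by auto
    have "(g ^^ i) (Z (Suc n)) = (F (Suc n) ^^ i) (Z (Suc n))" for i
      by (rule iterate_cong[OF Fsd g(3) Z(1)])
    then show ?thesis using Z KZ[of n] n Xs(2)[of "Suc n"] by (intro bexI[of _ "Z (Suc n)"]) auto
  qed
  ultimately have "good e g" unfolding good_def using g(1,2) e x0 by auto
  moreover have "g y = f y" if "y \<in> {0..x}" for y using g(3)[of y 0] that X0 F0 by auto
  moreover have "min z (f x) \<le> g y" if "y \<in> {x..e}" for y using g(4)[of y 0] that X0 unfolding b_def by auto
  moreover have "g y < y" if y: "y \<in> {x<..<e}" for y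
  proof -
    have "eventually (\<lambda>n. y < X n) sequentially" using y by (intro order_tendstoD(1)[OF Xl]) auto
    then obtain m0 where m0: "y \<le> X m0" unfolding eventually_sequentially using less_imp_le by blast
    define m where "m = (LEAST m. y \<le> X m)"
    have m: "y \<le> X m" unfolding m_def using m0 by (rule LeastI)
    have "m \<noteq> 0" using m y X0 by (cases m) auto
    then obtain j where j: "m = Suc j" using not0_implies_Suc by blast
    have "X j < y" using not_less_Least[of j "\<lambda>m. y \<le> X m"] j unfolding m_def by auto
    then show ?thesis using Flt[of y j] m j g(3)[of y m] y x0 by auto
  qed
  ultimately show ?thesis using that by blast
qed

text \<open>The degenerate start, whose extension yields the first positive fixed point.\<close>

lemma good_zero: "good 0 (\<lambda>_. 0)"
  unfolding good_def subdiagonal_def crooked_on_def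
proof (intro conjI allI impI)
  have "((\<lambda>_::real. 0::real) ^^ i) 0 = 0" for i by (induction i) auto
  then show "\<exists>w\<in>{0..0}. 0 - \<eta> < w \<and> (\<lambda>i. ((\<lambda>_::real. 0::real) ^^ i) w) \<longlonglongrightarrow> 0" if "\<eta> > 0" for \<eta> :: real
    using that by auto
qed (auto intro!: zigzag_close exI[of _ 0])

text \<open>Right of \<open>p\<close> the map is first flat or dips slightly, according to
  \<open>flag\<close>, and is back at \<open>p\<close> in \<open>x\<close>. As \<open>p\<close> is
  fixed and bounds all values so far, the orbit of \<open>x\<close> dominates and a stage arises. A
  dip needs room below, hence \<open>0 < p\<close>.\<close>

lemma good_extend:
  assumes gd: "good p f" and e: "p < e" and \<eta>: "\<eta> > 0" and flag: "\<not> flag \<Longrightarrow> 0 < p"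
  obtains g where "good e g" "\<And>y. y \<in> {0..p} \<Longrightarrow> g y = f y" "\<And>y. y \<in> {p<..<e} \<Longrightarrow> g y < y"
    "\<And>y. y \<in> {p..e} \<Longrightarrow> p - \<eta> \<le> g y"
    "flag \<longleftrightarrow> (\<exists>r>0. p + r < e \<and> (\<forall>y\<in>{p..p + r}. g y = p))"
proof -
  have p0: "0 \<le> p" and f: "subdiagonal p f" "f p = p" "crooked_on p f"
    using gd unfolding good_def by auto
  obtain w where w: "w \<in> {0..p}" "p - \<eta> < w" "(\<lambda>i. (f ^^ i) w) \<longlonglongrightarrow> 0"
    using gd \<eta> unfolding good_def by blast
  define x where "x = (p + e) / 2"
  have x: "p < x" "x < e" using e unfolding x_def by auto
  \<comment> \<open>The depth is bounded by \<open>p\<close> to keep values nonnegative and by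
    \<eta> to keep them close to \<open>p\<close>; slope 0 is the flat case.\<close>
  define c where "c = (if flag then 0 else min p \<eta> / (x - p))"
  have c: "0 \<le> c" "c * (x - p) \<le> p" "c * (x - p) \<le> \<eta>" "\<not> flag \<Longrightarrow> 0 < c"
    using x p0 \<eta> flag unfolding c_def by auto
  define f0 where "f0 y = (if y \<le> p then f y else p - c * min (y - p) (x - y))" for y
  have f0f: "f0 y = f y" if "y \<le> p" for y using that unfolding f0_def by auto
  have f0t: "f0 y = p - c * min (y - p) (x - y)" if "y \<in> {p..x}" for y
    using that f(2) x unfolding f0_def by (cases "y = p") auto
  have dip: "0 \<le> c * min (y - p) (x - y)" "c * min (y - p) (x - y) \<le> c * (x - p)" if "y \<in> {p..x}" for y
    using that c(1) by (auto intro!: mult_left_mono)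
  have f0x: "f0 x = p" using f0t[of x] x by auto
  have sd0: "subdiagonal x f0" unfolding subdiagonal_def
  proof (intro conjI ballI)
    have "continuous_on ({0..p} \<union> {p..x}) f0"
    proof (intro continuous_on_closed_Un closed_atLeastAtMost)
      show "continuous_on {0..p} f0"
        using f(1) f0f unfolding subdiagonal_def by (metis atLeastAtMost_iff continuous_on_eq)
      have "continuous_on {p..x} (\<lambda>y. p - c * min (y - p) (x - y))" by (intro continuous_intros)
      then show "continuous_on {p..x} f0" by (rule continuous_on_eq) (use f0t in auto)
    qed
    moreover have "{0..p} \<union> {p..x} = {0..x}" using x p0 by auto
    ultimately show "continuous_on {0..x} f0" by simp
    fix y assume y: "y \<in> {0..x}"
    have "0 \<le> f0 y \<and> f0 y \<le> y"
    proof (cases "y \<le> p")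
      case True then show ?thesis using f0f f(1) y unfolding subdiagonal_def by auto
    next
      case False
      then have "y \<in> {p..x}" using y by auto
      then show ?thesis using f0t[of y] dip[of y] c(2) by auto
    qed
    then show "0 \<le> f0 y" "f0 y \<le> y" by auto
  qed
  have f0p: "f0 y \<le> p" if "y \<in> {0..x}" for y
    using f0f[of y] f0t[of y] dip[of y] f(1) that unfolding subdiagonal_def by (cases "y \<le> p") force+
  have "stage x f0 w" unfolding stage_def
  proof (intro conjI allI ballI)
    show "crooked_on x f0"
    proof (rule crooked_on_extend[OF sd0 p0])
      show "crooked_on p f0" using crooked_on_cong[OF f(1,3)] f0f by auto
      show "f0 y < y" if "y \<in> {p<..x}" for y using f0p[of y] that p0 by auto
    qed (use x in auto)
    have "(f0 ^^ i) w = (f ^^ i) w" for i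
      by (rule iterate_cong[OF f(1) _ w(1)]) (simp add: f0f)
    then show "(\<lambda>i. (f0 ^^ i) w) \<longlonglongrightarrow> 0" using w(3) by simp
    fix l v assume v: "v \<in> {0..x}"
    show "(f0 ^^ l) v \<le> (f0 ^^ l) x"
    proof (cases l)
      case (Suc l')
      have fv: "f0 v \<in> {0..x}" using f0p[OF v] sd0 v x unfolding subdiagonal_def by auto
      have "(f0 ^^ l') (f0 v) \<le> p" using subdiagonal_iterate[OF sd0 fv, of l'] f0p[OF v] by auto
      moreover have "(f0 ^^ l') p = p" by (induction l') (use f0f f in auto)
      ultimately show ?thesis using Suc f0x by (simp add: funpow_swap1)
    qed (use v in auto)
  qed (use sd0 f0x x w in auto)
  from stage_limit[OF this x(2)] obtain g where g: "good e g" "\<And>y. y \<in> {0..x} \<Longrightarrow> g y = f0 y"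
    "\<And>y. y \<in> {x<..<e} \<Longrightarrow> g y < y" "\<And>y. y \<in> {x..e} \<Longrightarrow> min w (f0 x) \<le> g y" by blast
  have gt: "g y = p - c * min (y - p) (x - y)" if "y \<in> {p..x}" for y using g(2)[of y] f0t that p0 by auto
  show ?thesis
  proof (rule that[OF g(1)])
    show "g y = f y" if "y \<in> {0..p}" for y using g(2)[of y] f0f that x by auto
    show "g y < y" if y: "y \<in> {p<..<e}" for y
    proof (cases "y \<le> x")
      case True then show ?thesis using gt[of y] dip[of y] y by auto
    next
      case False then show ?thesis using g(3) y by auto
    qed
    show "p - \<eta> \<le> g y" if y: "y \<in> {p..e}" for y
    proof (cases "y \<le> x")
      case True then show ?thesis using gt[of y] dip[of y] y c(3) by auto
    next
      case False then show ?thesis using g(4)[of y] y f0x w \<eta> by auto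
    qed
    show "flag \<longleftrightarrow> (\<exists>r>0. p + r < e \<and> (\<forall>y\<in>{p..p + r}. g y = p))"
    proof
      assume flag
      then have "g y = p" if "y \<in> {p..x}" for y using gt[OF that] unfolding c_def by auto
      then show "\<exists>r>0. p + r < e \<and> (\<forall>y\<in>{p..p + r}. g y = p)" using x by (intro exI[of _ "x - p"]) auto
    next
      assume "\<exists>r>0. p + r < e \<and> (\<forall>y\<in>{p..p + r}. g y = p)"
      then obtain r where r: "r > 0" "\<And>y. y \<in> {p..p + r} \<Longrightarrow> g y = p" by blast
      \<comment> \<open>Inside the supposedly flat piece, yet strictly between \<open>p\<close> and
        \<open>x\<close>, where the dip would be positive.\<close>
      define y where "y = p + min r (x - p) / 2"
      have y: "y \<in> {p..p + r}" "p < y" "y < x" using r x unfolding y_def by (auto simp: min_def field_simps)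
      show flag
      proof (rule ccontr)
        assume "\<not> flag"
        then have "0 < c * min (y - p) (x - y)" using c(4) y by simp
        then show False using r(2)[OF y(1)] gt[of y] y by auto
      qed
    qed
  qed
qed

subsection \<open>Infinitely many fixed points\<close>

text \<open>One step leads back to \<open>[p, e]\<close>, where the induction hypothesis applies, or
  just below \<open>p\<close>, where \<open>g\<close> is \<open>f\<close> and \<open>f ^^ N\<close>
  is continuous at its fixed point \<open>p\<close>. So \<epsilon> does not depend on the
  continuation.\<close>

lemma close_iterate:
  assumes sd: "subdiagonal p f" and fp: "f p = p" and p: "0 \<le> p" and \<delta>: "\<delta> > 0"
  shows "\<exists>\<epsilon>>0. \<forall>g e. subdiagonal e g \<longrightarrow> (\<forall>y\<in>{0..p}. g y = f y) \<longrightarrow> e \<le> p + \<epsilon> \<longrightarrow>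
    (\<forall>y\<in>{p..e}. p - \<epsilon> \<le> g y) \<longrightarrow> (\<forall>y\<in>{p..e}. \<bar>(g ^^ N) y - p\<bar> \<le> \<delta>)"
proof (induction N)
  case 0
  show ?case using \<delta> by (intro exI[of _ \<delta>]) auto
next
  case (Suc N)
  then obtain \<epsilon>1 where 1: "\<epsilon>1 > 0" "\<And>g e y. subdiagonal e g \<Longrightarrow> (\<forall>y\<in>{0..p}. g y = f y) \<Longrightarrow> e \<le> p + \<epsilon>1 \<Longrightarrow>
    (\<forall>y\<in>{p..e}. p - \<epsilon>1 \<le> g y) \<Longrightarrow> y \<in> {p..e} \<Longrightarrow> \<bar>(g ^^ N) y - p\<bar> \<le> \<delta>" by blast
  obtain \<epsilon>2 where 2: "\<epsilon>2 > 0" "\<And>y y'. y \<in> {0..p} \<Longrightarrow> y' \<in> {0..p} \<Longrightarrow> \<bar>y - y'\<bar> < \<epsilon>2 \<Longrightarrow>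
    \<bar>(f ^^ N) y - (f ^^ N) y'\<bar> < \<delta>"
    using uniform_modulus[OF continuous_on_iterate[OF sd, of N] \<delta>] by blast
  have fNp: "(f ^^ N) p = p" by (induction N) (use fp in auto)
  define \<epsilon> where "\<epsilon> = min \<epsilon>1 (\<epsilon>2 / 2)"
  have \<epsilon>: "\<epsilon> > 0" "\<epsilon> \<le> \<epsilon>1" "\<epsilon> < \<epsilon>2" using 1(1) 2(1) unfolding \<epsilon>_def by auto
  have "\<bar>(g ^^ Suc N) y - p\<bar> \<le> \<delta>"
    if g: "subdiagonal e g" "\<forall>y\<in>{0..p}. g y = f y" "e \<le> p + \<epsilon>" "\<forall>y\<in>{p..e}. p - \<epsilon> \<le> g y" and y: "y \<in> {p..e}" for g e y
  proof -
    have gy: "0 \<le> g y" "g y \<le> y" using g(1) y p unfolding subdiagonal_def by auto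
    have "\<bar>(g ^^ N) (g y) - p\<bar> \<le> \<delta>"
    proof (cases "p \<le> g y")
      case True
      show ?thesis
      proof (rule 1(2)[OF g(1,2)])
        show "\<forall>y\<in>{p..e}. p - \<epsilon>1 \<le> g y" using g(4) \<epsilon>(2) by force
      qed (use g(3) \<epsilon>(2) True gy y in auto)
    next
      case False
      have "(g ^^ N) (g y) = (f ^^ N) (g y)"
        by (rule iterate_cong[OF sd]) (use g(2) gy False in auto)
      moreover have "p - \<epsilon> \<le> g y" using g(4) y by blast
      then have "\<bar>(f ^^ N) (g y) - (f ^^ N) p\<bar> < \<delta>" using gy False \<epsilon> p by (intro 2(2)) auto
      ultimately show ?thesis using fNp by simp
    qed
    then show ?thesis by (simp add: funpow_swap1)
  qed
  then show ?case using \<epsilon>(1) by blast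
qed

text \<open>One exponent serves all continuations within \<beta> of \<open>p\<close>, in domain and
  in values; hence the property passes to the limit of infinitely many extensions.\<close>

definition persistent :: "real \<Rightarrow> real \<Rightarrow> real \<Rightarrow> (real \<Rightarrow> real) \<Rightarrow> bool" where
  "persistent \<delta> \<beta> p f \<longleftrightarrow> (\<exists>N. \<forall>g e. subdiagonal e g \<longrightarrow> (\<forall>y\<in>{0..p}. g y = f y) \<longrightarrow> p \<le> e \<longrightarrow>
     e \<le> p + \<beta> \<longrightarrow> (\<forall>y\<in>{p..e}. p - \<beta> \<le> g y) \<longrightarrow> (\<forall>c\<in>{0..e}. \<forall>d\<in>{0..e}. zigzag \<delta> (g ^^ N) c d))"

lemma good_imp_persistent:
  assumes gd: "good p f" and \<delta>: "\<delta> > 0" and \<gamma>: "\<gamma> > 0"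
  obtains \<beta> where "0 < \<beta>" "\<beta> \<le> \<gamma>" "persistent \<delta> \<beta> p f"
proof -
  have p: "0 \<le> p" and f: "subdiagonal p f" "f p = p" "crooked_on p f" using gd unfolding good_def by auto
  have \<delta>3: "\<delta> / 3 > 0" using \<delta> by simp
  then obtain N where N: "\<And>c d. c \<in> {0..p} \<Longrightarrow> d \<in> {0..p} \<Longrightarrow> zigzag (\<delta> / 3) (f ^^ N) c d"
    using f(3) unfolding crooked_on_def by blast
  obtain \<epsilon> where \<epsilon>: "\<epsilon> > 0" "\<And>g e y. subdiagonal e g \<Longrightarrow> (\<forall>y\<in>{0..p}. g y = f y) \<Longrightarrow> e \<le> p + \<epsilon> \<Longrightarrow>
    (\<forall>y\<in>{p..e}. p - \<epsilon> \<le> g y) \<Longrightarrow> y \<in> {p..e} \<Longrightarrow> \<bar>(g ^^ N) y - p\<bar> \<le> \<delta> / 3"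
    using close_iterate[OF f(1,2) p \<delta>3, of N] by blast
  define \<beta> where "\<beta> = min \<epsilon> \<gamma>"
  have \<beta>: "0 < \<beta>" "\<beta> \<le> \<gamma>" "\<beta> \<le> \<epsilon>" using \<epsilon>(1) \<gamma> unfolding \<beta>_def by auto
  have fNp: "(f ^^ N) p = p" by (induction N) (use f in auto)
  have "zigzag \<delta> (g ^^ N) c d"
    if g: "subdiagonal e g" "\<forall>y\<in>{0..p}. g y = f y" "p \<le> e" "e \<le> p + \<beta>" "\<forall>y\<in>{p..e}. p - \<beta> \<le> g y"
      and cd: "c \<in> {0..e}" "d \<in> {0..e}" for g e c d
  proof -
    \<comment> \<open>Retracting onto \<open>[0, p]\<close> keeps the iterate crooked; for
      \<open>y\<close> beyond \<open>p\<close> it gives exactly \<open>p\<close>, and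
      \<open>g ^^ N\<close> is near \<open>p\<close> there.\<close>
    have "zigzag (\<delta> / 3) (\<lambda>y. (f ^^ N) (min y p)) c d"
      by (rule zigzag_lift[where Q = "\<lambda>y. min y p" and H = "f ^^ N"])
        (use cd p N in \<open>auto intro!: continuous_intros\<close>)
    then have "zigzag (\<delta> / 3 + 2 * (\<delta> / 3)) (g ^^ N) c d"
    proof (rule zigzag_approx)
      fix y assume "y \<in> closed_segment c d"
      then have y: "y \<in> {0..e}" using segment_subset_interval[OF cd] by blast
      show "\<bar>(f ^^ N) (min y p) - (g ^^ N) y\<bar> \<le> \<delta> / 3"
      proof (cases "y \<le> p")
        case True
        then have "(g ^^ N) y = (f ^^ N) y" using iterate_cong[OF f(1), of g y N] g(2) y by auto
        then show ?thesis using True \<delta> by (simp add: min_def)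
      next
        case False
        have "\<bar>(g ^^ N) y - p\<bar> \<le> \<delta> / 3"
        proof (rule \<epsilon>(2)[OF g(1,2)])
          show "\<forall>y\<in>{p..e}. p - \<epsilon> \<le> g y" using g(5) \<beta>(3) by force
        qed (use g(4) \<beta>(3) False y in auto)
        then show ?thesis using False fNp by (simp add: min_def abs_minus_commute)
      qed
    qed
    then show ?thesis by simp
  qed
  then have "persistent \<delta> \<beta> p f" unfolding persistent_def by blast
  then show ?thesis using that \<beta> by blast
qed

lemma coded_map:
  fixes r :: real and S :: "nat set"
  assumes r: "0 < r" "r < 1"
  obtains f and p :: "nat \<Rightarrow> real" where "good 1 f" "p 0 = r" "\<And>k. p k < p (Suc k)" "\<And>k. p k \<in> {0<..<1}"
    "\<And>k. f (p k) = p k" "\<And>y. y \<in> {0<..<r} \<Longrightarrow> f y < y"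
    "\<And>k y. y \<in> {p k<..<p (Suc k)} \<Longrightarrow> f y < y"
    "\<And>k. k \<in> S \<longleftrightarrow> (\<exists>\<rho>>0. p k + \<rho> < p (Suc k) \<and> (\<forall>y\<in>{p k..p k + \<rho>}. f y = p k))"
proof -
  obtain f0 where f0: "good r f0" "\<And>y. y \<in> {0<..<r} \<Longrightarrow> f0 y < y"
    using good_extend[OF good_zero r(1) zero_less_one, of True] by metis
  define P where "P k s \<longleftrightarrow> (case s of (f, p, \<beta>) \<Rightarrow>
      good p f \<and> 0 < p \<and> 0 < \<beta> \<and> persistent (1 / 2 ^ k) \<beta> p f \<and>
      (k = 0 \<longrightarrow> f = f0 \<and> p = r \<and> p + \<beta> < 1))" for k and s :: "(real \<Rightarrow> real) \<times> real \<times> real"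
  \<comment> \<open>Here \<open>\<beta>\<close> is the room reserved around \<open>p\<close>.
    Advancing by half of it and at least halving it makes \<open>p + \<beta>\<close> decrease and
    \<open>p - \<beta>\<close> increase, so all later maps and their limit respect every earlier
    reservation.\<close>
  define Q where "Q k s s' \<longleftrightarrow> (case s of (f, p, \<beta>) \<Rightarrow> case s' of (f', p', \<beta>') \<Rightarrow>
      p' = p + \<beta> / 2 \<and> \<beta>' \<le> \<beta> / 2 \<and> (\<forall>y\<in>{0..p}. f' y = f y) \<and> (\<forall>y\<in>{p<..<p'}. f' y < y) \<and>
      (\<forall>y\<in>{p..p'}. p - \<beta> \<le> f' y) \<and>
      (k \<in> S \<longleftrightarrow> (\<exists>\<rho>>0. p + \<rho> < p' \<and> (\<forall>y\<in>{p..p + \<rho>}. f' y = p))))"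
    for k and s s' :: "(real \<Rightarrow> real) \<times> real \<times> real"
  have "\<exists>T. \<forall>k. P k (T k) \<and> Q k (T k) (T (Suc k))"
  proof (rule dependent_nat_choice)
    \<comment> \<open>Limiting the room to half of the distance to 1 lets the fixed points
      accumulate at some \<open>e < 1\<close>.\<close>
    have pos: "(1 - r) / 2 > 0" using r by simp
    obtain \<beta> where "0 < \<beta>" "\<beta> \<le> (1 - r) / 2" "persistent (1 / 2 ^ 0) \<beta> r f0"
      by (rule good_imp_persistent[OF f0(1) _ pos, of "1 / 2 ^ 0"]) auto
    then show "\<exists>s. P 0 s" unfolding P_def using f0 r by (intro exI[of _ "(f0, r, \<beta>)"]) auto
    fix s k assume "P k s"
    then obtain f p \<beta> where s: "s = (f, p, \<beta>)" and *: "good p f" "0 < p" "0 < \<beta>"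
      unfolding P_def by (cases s) auto
    have pos: "p < p + \<beta> / 2" using * by simp
    obtain g where g: "good (p + \<beta> / 2) g" "\<And>y. y \<in> {0..p} \<Longrightarrow> g y = f y"
      "\<And>y. y \<in> {p<..<p + \<beta> / 2} \<Longrightarrow> g y < y" "\<And>y. y \<in> {p..p + \<beta> / 2} \<Longrightarrow> p - \<beta> \<le> g y"
      "k \<in> S \<longleftrightarrow> (\<exists>\<rho>>0. p + \<rho> < p + \<beta> / 2 \<and> (\<forall>y\<in>{p..p + \<rho>}. g y = p))"
      by (rule good_extend[OF *(1) pos *(3), where flag = "k \<in> S"]) (use * in auto)
    have pos: "\<beta> / 2 > 0" using * by simp
    obtain \<beta>' where \<beta>': "0 < \<beta>'" "\<beta>' \<le> \<beta> / 2" "persistent (1 / 2 ^ Suc k) \<beta>' (p + \<beta> / 2) g"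
      by (rule good_imp_persistent[OF g(1) _ pos, of "1 / 2 ^ Suc k"]) auto
    have "P (Suc k) (g, p + \<beta> / 2, \<beta>')" unfolding P_def using g(1) \<beta>' * by simp
    moreover have "Q k s (g, p + \<beta> / 2, \<beta>')"
      unfolding Q_def s prod.case by (intro conjI ballI g(2-5) \<beta>'(2) refl)
    ultimately show "\<exists>s'. P (Suc k) s' \<and> Q k s s'" by blast
  qed
  then obtain T where T: "\<And>k. P k (T k)" "\<And>k. Q k (T k) (T (Suc k))" by blast
  define F where "F k = fst (T k)" for k
  define p where "p k = fst (snd (T k))" for k
  define \<beta> where "\<beta> k = snd (snd (T k))" for k
  have Te: "T k = (F k, p k, \<beta> k)" for k unfolding F_def p_def \<beta>_def by simp
  have gd: "good (p k) (F k)" and p0: "0 < p k" and \<beta>0: "0 < \<beta> k" and pers: "persistent (1 / 2 ^ k) (\<beta> k) (p k) (F k)"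
    and init: "k = 0 \<Longrightarrow> F k = f0 \<and> p k = r \<and> p k + \<beta> k < 1" for k
    using T(1)[of k] unfolding P_def Te by auto
  have ps: "p (Suc k) = p k + \<beta> k / 2" and \<beta>s: "\<beta> (Suc k) \<le> \<beta> k / 2"
    and Fext: "\<And>y. y \<in> {0..p k} \<Longrightarrow> F (Suc k) y = F k y"
    and Flt: "\<And>y. y \<in> {p k<..<p (Suc k)} \<Longrightarrow> F (Suc k) y < y"
    and Fge: "\<And>y. y \<in> {p k..p (Suc k)} \<Longrightarrow> p k - \<beta> k \<le> F (Suc k) y"
    and Fbit: "k \<in> S \<longleftrightarrow> (\<exists>\<rho>>0. p k + \<rho> < p (Suc k) \<and> (\<forall>y\<in>{p k..p k + \<rho>}. F (Suc k) y = p k))" for k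
    using T(2)[of k] unfolding Q_def Te prod.case by blast+
  have Fsd: "subdiagonal (p k) (F k)" and Fp: "F k (p k) = p k" for k using gd unfolding good_def by auto
  have psm: "strict_mono p" using ps \<beta>0 by (simp add: strict_mono_Suc_iff)
  have dec: "decseq (\<lambda>k. p k + \<beta> k)"
  proof (rule decseq_SucI)
    fix k show "p (Suc k) + \<beta> (Suc k) \<le> p k + \<beta> k" using ps[of k] \<beta>s[of k] by simp
  qed
  have inc: "incseq (\<lambda>k. p k - \<beta> k)"
  proof (rule incseq_SucI)
    fix k show "p k - \<beta> k \<le> p (Suc k) - \<beta> (Suc k)" using ps[of k] \<beta>s[of k] \<beta>0[of k] by simp
  qed
  have pb: "p j \<le> p k + \<beta> k" for j k
  proof (cases "j \<le> k")
    case True then show ?thesis using strict_mono_less_eq[OF psm, of j k] \<beta>0[of k] by simp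
  next
    case False then show ?thesis using decseqD[OF dec, of k j] \<beta>0[of j] by simp
  qed
  have \<beta>pow: "\<beta> k \<le> \<beta> 0 * (1 / 2) ^ k" for k
  proof (induction k)
    case (Suc k) then show ?case using \<beta>s[of k] by simp
  qed simp
  have "(\<lambda>k. \<beta> 0 * (1 / 2) ^ k) \<longlonglongrightarrow> \<beta> 0 * 0" by (intro tendsto_mult_left LIMSEQ_power_zero) auto
  then have upper: "(\<lambda>k. \<beta> 0 * (1 / 2) ^ k) \<longlonglongrightarrow> 0" by (simp only: mult_zero_right)
  have \<beta>l: "\<beta> \<longlonglongrightarrow> 0"
  proof (rule tendsto_sandwich[OF _ _ tendsto_const upper])
    show "\<forall>\<^sub>F k in sequentially. 0 \<le> \<beta> k"
      by (rule always_eventually) (intro allI less_imp_le \<beta>0)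
    show "\<forall>\<^sub>F k in sequentially. \<beta> k \<le> \<beta> 0 * (1 / 2) ^ k"
      by (rule always_eventually) (intro allI \<beta>pow)
  qed
  have "incseq p" using psm by (simp add: strict_mono_mono)
  then obtain e where e: "p \<longlonglongrightarrow> e" using incseq_convergent[OF \<open>incseq p\<close>, of "p 0 + \<beta> 0"] pb by blast
  have eb: "e \<le> p k + \<beta> k" for k using LIMSEQ_le_const2[OF e] pb by blast
  have pe: "p k < e" for k
    using incseq_le[OF \<open>incseq p\<close> e, of "Suc k"] strict_monoD[OF psm, of k "Suc k"] by simp
  have e1: "e < 1" using eb[of 0] init[of 0] by simp
  have "(\<lambda>k. p k - \<beta> k) \<longlonglongrightarrow> e - 0" by (intro tendsto_diff e \<beta>l)
  then have bl: "(\<lambda>k. p k - \<beta> k) \<longlonglongrightarrow> e" by simp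
  obtain g where g: "subdiagonal e g" "g e = e" "\<And>k y. y \<in> {0..p k} \<Longrightarrow> g y = F k y"
    "\<And>k y. y \<in> {p k..e} \<Longrightarrow> p k - \<beta> k \<le> g y"
  proof (rule glue[OF psm e less_imp_le[OF p0] Fsd Fext inc bl Fge])
    fix g assume "subdiagonal e g" "g e = e" "\<And>k y. y \<in> {0..p k} \<Longrightarrow> g y = F k y"
      "\<And>k y. y \<in> {p k..e} \<Longrightarrow> p k - \<beta> k \<le> g y"
    then show thesis by (rule that)
  qed
  have "crooked_on e g" unfolding crooked_on_def
  proof (intro allI impI)
    fix \<delta> :: real assume "\<delta> > 0"
    then obtain k where k: "(1 / 2) ^ k < \<delta>" using real_arch_pow_inv[of \<delta> "1/2"] by auto
    from pers[of k] obtain N where "\<forall>c\<in>{0..e}. \<forall>d\<in>{0..e}. zigzag (1 / 2 ^ k) (g ^^ N) c d"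
      unfolding persistent_def using g(1,3,4) less_imp_le[OF pe[of k]] eb[of k] by blast
    moreover have "1 / 2 ^ k \<le> \<delta>" using k by (simp add: power_one_over)
    ultimately show "\<exists>N. \<forall>c\<in>{0..e}. \<forall>d\<in>{0..e}. zigzag \<delta> (g ^^ N) c d" using zigzag_mono by blast
  qed
  moreover have "\<exists>w\<in>{0..e}. e - \<eta> < w \<and> (\<lambda>i. (g ^^ i) w) \<longlonglongrightarrow> 0" if "\<eta> > 0" for \<eta>
  proof -
    have "eventually (\<lambda>k. e - \<eta> / 2 < p k) sequentially" using that by (intro order_tendstoD(1)[OF e]) auto
    then obtain k where k: "e - \<eta> / 2 < p k" unfolding eventually_sequentially by blast
    have "\<eta> / 2 > 0" using that by simp
    then obtain w where w: "w \<in> {0..p k}" "p k - \<eta> / 2 < w" "(\<lambda>i. (F k ^^ i) w) \<longlonglongrightarrow> 0"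
      using gd[of k] unfolding good_def by blast
    have "(g ^^ i) w = (F k ^^ i) w" for i by (rule iterate_cong[OF Fsd g(3) w(1)])
    then show ?thesis using w k pe[of k] by (intro bexI[of _ w]) auto
  qed
  ultimately have "good e g" unfolding good_def using g(1,2) pe[of 0] p0[of 0] by auto
  \<comment> \<open>A last extension fixes 1 and completes the domain, leaving the code on
    \<open>[0, e]\<close> intact.\<close>
  from good_extend[OF this e1 zero_less_one, of True] obtain f where f: "good 1 f" "\<And>y. y \<in> {0..e} \<Longrightarrow> f y = g y"
    by metis
  have fF: "f y = F k y" if "y \<in> {0..p k}" for y k using f(2)[of y] g(3)[OF that] that pe[of k] by auto
  show ?thesis
  proof (rule that[OF f(1), of p])
    show "p 0 = r" using init by simp
    show "p k < p (Suc k)" for k using strict_monoD[OF psm, of k "Suc k"] by simp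
    show "p k \<in> {0<..<1}" for k using p0[of k] pe[of k] e1 by auto
    show "f (p k) = p k" for k using fF[of "p k" k] p0[of k] Fp[of k] by auto
    show "f y < y" if "y \<in> {0<..<r}" for y using fF[of y 0] that init[of 0] f0(2) by auto
    show "f y < y" if "y \<in> {p k<..<p (Suc k)}" for k y using fF[of y "Suc k"] that Flt[OF that] p0[of k] by auto
    have "f y = F (Suc k) y" if "y \<in> {p k..p k + \<rho>}" "p k + \<rho> < p (Suc k)" for y k \<rho>
      using fF[of y "Suc k"] that p0[of k] by auto
    then show "k \<in> S \<longleftrightarrow> (\<exists>\<rho>>0. p k + \<rho> < p (Suc k) \<and> (\<forall>y\<in>{p k..p k + \<rho>}. f y = p k))" for k
      unfolding Fbit[of k] by (metis (no_types, lifting))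
  qed
qed

subsection \<open>Conjugacy\<close>

text \<open>With no other positive fixed points before or between the \<open>p k\<close>, order
  alone recovers each \<open>p k\<close> from \<open>f\<close>; this is why the code survives an
  increasing conjugacy.\<close>

definition codes :: "(real \<Rightarrow> real) \<Rightarrow> (nat \<Rightarrow> real) \<Rightarrow> nat set \<Rightarrow> bool" where
  "codes f p S \<longleftrightarrow> (\<forall>k. p k < p (Suc k) \<and> p k \<in> {0<..<1} \<and> f (p k) = p k \<and>
     (\<forall>y\<in>{p k<..<p (Suc k)}. f y < y) \<and>
     (k \<in> S \<longleftrightarrow> (\<exists>\<rho>>0. p k + \<rho> < p (Suc k) \<and> (\<forall>y\<in>{p k..p k + \<rho>}. f y = p k)))) \<and>
   (\<forall>y\<in>{0<..<p 0}. f y < y)"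

lemma codes_next_le:
  assumes "codes f p S" "f y = y" "p k < y"
  shows "p (Suc k) \<le> y"
proof (rule ccontr)
  assume "\<not> ?thesis"
  then have "y \<in> {p k<..<p (Suc k)}" using assms(3) by simp
  then have "f y < y" using assms(1) unfolding codes_def by blast
  then show False using assms(2) by simp
qed

lemma codes_first_le:
  assumes "codes f p S" "f y = y" "0 < y"
  shows "p 0 \<le> y"
proof (rule ccontr)
  assume "\<not> ?thesis"
  then have "y \<in> {0<..<p 0}" using assms(3) by simp
  then have "f y < y" using assms(1) unfolding codes_def by blast
  then show False using assms(2) by simp
qed

text \<open>A decreasing homeomorphism would turn values below the diagonal into values above
  it.\<close>

lemma conjugate_increasing:
  assumes f: "subdiagonal 1 f" and g: "subdiagonal 1 g" and lt: "y0 \<in> {0..1}" "g y0 < y0"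
    and h: "homeomorphism {0..1} {0..1} h h'" and conj: "\<And>x. x \<in> {0..1} \<Longrightarrow> g x = h (f (h' x))"
  shows "strict_mono_on {0..1} h"
proof -
  have hc: "continuous_on {0..1} h" and hh': "\<And>x. x \<in> {0..1} \<Longrightarrow> h' (h x) = x" "\<And>x. x \<in> {0..1} \<Longrightarrow> h (h' x) = x"
    and him: "h ` {0..1} = {0..1}" "h' ` {0..1} = {0..1}"
    using h unfolding homeomorphism_def by auto
  have "inj_on h {0..1}" using hh'(1) by (rule inj_on_inverseI)
  then consider "strict_mono_on {0..1} h" | "strict_antimono_on {0..1} h"
    using injective_eq_monotone_map[OF is_interval_cc hc] by blast
  then show ?thesis
  proof cases
    case 2
    define x where "x = h' y0"
    have x: "x \<in> {0..1}" using him lt unfolding x_def by blast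
    then have fx: "f x \<in> {0..1}" "f x \<le> x" using f unfolding subdiagonal_def by force+
    have "h x \<le> h (f x)"
      using 2 fx x by (cases "f x = x") (auto simp: monotone_on_def less_eq_real_def)
    then have "y0 \<le> g y0" using conj[OF lt(1)] hh'(2)[OF lt(1)] unfolding x_def by simp
    then show ?thesis using lt by simp
  qed
qed


text \<open>Fixed points go to fixed points in the same order, and \<open>q k\<close> is the least
  candidate at position \<open>k\<close>. Applied to the inverse as well, the inequality becomes an
  equality.\<close>

lemma codes_transfer:
  assumes cf: "codes f p S" and cg: "codes g q S'" and h: "strict_mono_on {0..1} h" "h ` {0..1} = {0..1}"
    and conj: "\<And>x. x \<in> {0..1} \<Longrightarrow> g (h x) = h (f x)"
  shows "q k \<le> h (p k)"
proof (induction k)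
  case 0
  have p: "p 0 \<in> {0<..<1}" "f (p 0) = p 0" using cf unfolding codes_def by auto
  then have "h 0 < h (p 0)" using h(1) by (auto simp: monotone_on_def)
  moreover have "0 \<le> h 0" using h(2) by (metis atLeastAtMost_iff imageI order_refl zero_le_one)
  ultimately show ?case using codes_first_le[OF cg, of "h (p 0)"] conj[of "p 0"] p by auto
next
  case (Suc k)
  have p: "p k \<in> {0<..<1}" "p (Suc k) \<in> {0<..<1}" "p k < p (Suc k)" "f (p (Suc k)) = p (Suc k)"
    using cf unfolding codes_def by auto
  then have "h (p k) < h (p (Suc k))" using h(1) by (auto simp: monotone_on_def)
  then show ?case using codes_next_le[OF cg, of "h (p (Suc k))" k] conj[of "p (Suc k)"] p Suc by auto
qed

text \<open>The constancy interval at \<open>p k\<close> is carried onto one at \<open>q k\<close>,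
  ending at \<open>h (p k + \<rho>)\<close>. The other inclusion follows by exchanging the two
  maps.\<close>

lemma codes_subset:
  assumes cf: "codes f p S" and cg: "codes g q S'" and hm: "strict_mono_on {0..1} h"
    and hh': "\<And>y. y \<in> {0..1} \<Longrightarrow> h' y \<in> {0..1} \<and> h (h' y) = y"
    and conj: "\<And>x. x \<in> {0..1} \<Longrightarrow> g (h x) = h (f x)"
    and hp: "\<And>k. h (p k) = q k"
  shows "S \<subseteq> S'"
proof
  fix k assume "k \<in> S"
  then obtain \<rho> where \<rho>: "\<rho> > 0" "p k + \<rho> < p (Suc k)" "\<And>y. y \<in> {p k..p k + \<rho>} \<Longrightarrow> f y = p k"
    using cf unfolding codes_def by blast
  have p: "p k \<in> {0<..<1}" "p (Suc k) \<in> {0<..<1}" and q: "q k \<in> {0<..<1}" "q (Suc k) \<in> {0<..<1}"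
    using cf cg unfolding codes_def by auto
  have hle: "h u \<le> h v \<longleftrightarrow> u \<le> v" if "u \<in> {0..1}" "v \<in> {0..1}" for u v
    using strict_mono_on_less_eq[OF hm that] .
  have hlt: "h u < h v" if "u \<in> {0..1}" "v \<in> {0..1}" "u < v" for u v
    using hm that by (auto simp: monotone_on_def)
  define \<sigma> where "\<sigma> = h (p k + \<rho>) - q k"
  have "q k < h (p k + \<rho>)" using hlt[of "p k" "p k + \<rho>"] hp[of k] p \<rho>(1,2) by auto
  then have "\<sigma> > 0" unfolding \<sigma>_def by simp
  moreover have "h (p k + \<rho>) < q (Suc k)" using hlt[of "p k + \<rho>" "p (Suc k)"] hp[of "Suc k"] p \<rho>(1,2) by auto
  then have "q k + \<sigma> < q (Suc k)" unfolding \<sigma>_def by simp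
  moreover have "g y = q k" if y: "y \<in> {q k..q k + \<sigma>}" for y
  proof -
    have y01: "y \<in> {0..1}" using y q \<open>q k + \<sigma> < q (Suc k)\<close> by auto
    note x = hh'[OF y01]
    have "h (p k) \<le> h (h' y)" "h (h' y) \<le> h (p k + \<rho>)" using y x hp[of k] unfolding \<sigma>_def by auto
    then have "h' y \<in> {p k..p k + \<rho>}"
      using hle[of "p k" "h' y"] hle[of "h' y" "p k + \<rho>"] x p \<rho>(1,2) by auto
    then show ?thesis using conj[of "h' y"] x \<rho>(3) hp[of k] by metis
  qed
  ultimately show "k \<in> S'" using cg unfolding codes_def by blast
qed

lemma conjugate_codes:
  assumes f: "subdiagonal 1 f" "codes f p S" and g: "subdiagonal 1 g" "codes g q S'"
    and conj: "conjugate f g"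
  shows "S = S'"
proof -
  obtain h h' where h: "homeomorphism {0..1} {0..1} h h'" and c: "\<And>x. x \<in> {0..1} \<Longrightarrow> g x = h (f (h' x))"
    using conj unfolding conjugate_def by blast
  have hh': "\<And>x. x \<in> {0..1} \<Longrightarrow> h' (h x) = x" "\<And>x. x \<in> {0..1} \<Longrightarrow> h (h' x) = x"
    and him: "h ` {0..1} = {0..1}" "h' ` {0..1} = {0..1}"
    using h unfolding homeomorphism_def by auto
  have mem: "h x \<in> {0..1}" "h' x \<in> {0..1}" if "x \<in> {0..1}" for x using him that by blast+
  define y0 where "y0 = q 0 / 2"
  have q0: "q 0 \<in> {0<..<1}" "\<forall>y\<in>{0<..<q 0}. g y < y" using g(2) unfolding codes_def by blast+
  then have "y0 \<in> {0<..<q 0}" unfolding y0_def by simp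
  then have y0: "y0 \<in> {0..1}" "g y0 < y0" using q0 by auto
  have hm: "strict_mono_on {0..1} h" by (rule conjugate_increasing[OF f(1) g(1) y0 h c])
  have hm': "strict_mono_on {0..1} h'"
  proof (rule monotone_onI)
    fix u v :: real assume uv: "u \<in> {0..1}" "v \<in> {0..1}" "u < v"
    show "h' u < h' v"
      using strict_mono_on_less[OF hm mem(2)[OF uv(1)] mem(2)[OF uv(2)]] hh'(2) uv by simp
  qed
  have cg: "g (h x) = h (f x)" if "x \<in> {0..1}" for x using c[OF mem(1)[OF that]] hh'(1)[OF that] by simp
  have fm: "f x \<in> {0..1}" if "x \<in> {0..1}" for x using f(1) that unfolding subdiagonal_def by force
  have cf: "f (h' x) = h' (g x)" if "x \<in> {0..1}" for x
    using c[OF that] hh'(1)[OF fm[OF mem(2)[OF that]]] by simp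
  have p: "p k \<in> {0..1}" and q: "q k \<in> {0..1}" for k using f(2) g(2) unfolding codes_def by (auto simp: less_imp_le)
  have 1: "q k \<le> h (p k)" for k by (rule codes_transfer[OF f(2) g(2) hm him(1) cg])
  have 2: "p k \<le> h' (q k)" for k by (rule codes_transfer[OF g(2) f(2) hm' him(2) cf])
  have "h (p k) \<le> h (h' (q k))" for k using 2 strict_mono_on_less_eq[OF hm p mem(2)[OF q]] by blast
  then have hp: "h (p k) = q k" for k using 1[of k] hh'(2)[OF q] by (simp add: order_antisym)
  then have hq: "h' (q k) = p k" for k using hh'(1)[OF p] by metis
  have "S \<subseteq> S'" by (rule codes_subset[OF f(2) g(2) hm _ cg hp]) (use hh' mem in blast)
  moreover have "S' \<subseteq> S" by (rule codes_subset[OF g(2) f(2) hm' _ cf hq]) (use hh' mem in blast)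
  ultimately show ?thesis by blast
qed

section \<open>Assembling the uncountable family\<close>

lemma exists_coded_map:
  fixes r :: real
  assumes "0 < r" "r < 1"
  shows "\<exists>f p. good 1 f \<and> f \<in> extensional {0..1} \<and> codes f p S \<and> p 0 = r"
proof -
  obtain f p where f: "good 1 f" "p 0 = r" "\<And>k. p k < p (Suc k)" "\<And>k. p k \<in> {0<..<1}"
    "\<And>k. f (p k) = p k" "\<And>y. y \<in> {0<..<r} \<Longrightarrow> f y < y" "\<And>k y. y \<in> {p k<..<p (Suc k)} \<Longrightarrow> f y < y"
    "\<And>k. k \<in> S \<longleftrightarrow> (\<exists>\<rho>>0. p k + \<rho> < p (Suc k) \<and> (\<forall>y\<in>{p k..p k + \<rho>}. f y = p k))"
    by (rule coded_map[OF assms, of S]) blast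
  define f' where "f' = restrict f {0..1}"
  have ff': "f' y = f y" if "y \<in> {0..1}" for y using that unfolding f'_def by simp
  have sd: "subdiagonal 1 f" using f(1) unfolding good_def by blast
  have "subdiagonal 1 f'"
    using sd ff' unfolding subdiagonal_def by (metis (no_types, lifting) continuous_on_cong)
  moreover have "crooked_on 1 f'" using crooked_on_cong[OF sd _ ff'] f(1) unfolding good_def by blast
  moreover have "(f' ^^ i) w = (f ^^ i) w" if "w \<in> {0..1}" for i w by (rule iterate_cong[OF sd ff' that])
  ultimately have "good 1 f'" using f(1) ff' unfolding good_def by auto
  moreover have "codes f' p S"
  proof -
    have p01: "p k \<in> {0..1}" for k using f(4)[of k] by auto
    have a: "f' y = f y" if "p k + \<rho> < p (Suc k)" "y \<in> {p k..p k + \<rho>}" for k \<rho> y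
      using that f(4)[of k] f(4)[of "Suc k"] by (intro ff') auto
    have b: "f' y = f y" if "y \<in> {p k<..<p (Suc k)}" for k y
      using that f(4)[of k] f(4)[of "Suc k"] by (intro ff') auto
    have c: "f' y = f y" if "y \<in> {0<..<p 0}" for y using that f(4)[of 0] by (intro ff') auto
    show ?thesis
      unfolding codes_def
    proof (intro conjI allI ballI)
      show "k \<in> S \<longleftrightarrow> (\<exists>\<rho>>0. p k + \<rho> < p (Suc k) \<and> (\<forall>y\<in>{p k..p k + \<rho>}. f' y = p k))" for k
        unfolding f(8)[of k] using a by (metis (no_types, lifting))
    qed (use f(2-7) b c ff'[OF p01] in auto)
  qed
  ultimately show ?thesis using f(2) unfolding f'_def by blast
qed

lemma good_imp_crooked:
  assumes "good 1 f" "f \<in> extensional {0..1}"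
  shows "interval_map f \<and> under_diagonal f \<and> crooked f"
proof -
  have sd: "subdiagonal 1 f" and f: "f 1 = 1" "crooked_on 1 f" using assms unfolding good_def by auto
  have f0: "f 0 = 0" using sd unfolding subdiagonal_def by force
  have cont: "continuous_on {0..1} f" using sd unfolding subdiagonal_def by blast
  have "f ` {0..1} = {0..1}"
  proof
    show "f ` {0..1} \<subseteq> {0..1}" using sd unfolding subdiagonal_def by force
    show "{0..1} \<subseteq> f ` {0..1}" using IVT'[of f 0 _ 1] f f0 cont by force
  qed
  moreover have "crooked f"
    unfolding crooked_def delta_crooked_iff_zigzag using f(2) unfolding crooked_on_def by blast
  ultimately show ?thesis
    using assms(2) cont sd unfolding interval_map_def under_diagonal_def subdiagonal_def by auto
qed

theorem corollary4p7:
  shows "\<exists>F :: (real \<Rightarrow> real) set.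
    uncountable F \<and>
    (\<forall>f\<in>F. interval_map f \<and> under_diagonal f \<and> crooked f) \<and>
    (\<forall>f\<in>F. \<forall>g\<in>F. f \<noteq> g \<longrightarrow> \<not> conjugate f g \<and> Fix f \<noteq> Fix g)"
proof -
  \<comment> \<open>The Dedekind cut of \<open>r\<close>, via an enumeration of the rationals. The
    same \<open>r\<close> becomes code and least positive fixed point, so one parameter separates
    the members both up to conjugacy and by \<open>Fix\<close>.\<close>
  define S :: "real \<Rightarrow> nat set" where "S r = {k. of_rat (nat_to_rat_surj k) < r}" for r
  have S_mono: "S r \<noteq> S s" if rs: "r < s" for r s
  proof -
    obtain a where a: "r < of_rat a" "of_rat a < s" using of_rat_dense[OF rs] by blast
    obtain k where "a = nat_to_rat_surj k" using surj_nat_to_rat_surj by (metis surjD)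
    then have "k \<in> S s" "k \<notin> S r" using a unfolding S_def by auto
    then show ?thesis by blast
  qed
  have S_inj: "S r \<noteq> S s" if "r \<noteq> s" for r s
    using S_mono[of r s] S_mono[of s r] that by (metis linorder_neqE)
  have "\<forall>r\<in>{0<..<1}. \<exists>fp. good 1 (fst fp) \<and> fst fp \<in> extensional {0..1} \<and> codes (fst fp) (snd fp) (S r) \<and> snd fp 0 = r"
    using exists_coded_map by simp
  then obtain G where G: "\<And>r. r \<in> {0<..<1} \<Longrightarrow> good 1 (fst (G r)) \<and> fst (G r) \<in> extensional {0..1} \<and>
      codes (fst (G r)) (snd (G r)) (S r) \<and> snd (G r) 0 = r" by metis
  define E where "E r = fst (G r)" for r
  have FixE: "r = s" if r: "r \<in> {0<..<1}" and s: "s \<in> {0<..<1}" and eq: "Fix (E r) = Fix (E s)" for r s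
  proof -
    \<comment> \<open>\<open>u\<close> is a positive fixed point of \<open>E v\<close>, and the
      least of these is \<open>v\<close>.\<close>
    have le: "v \<le> u" if "u \<in> {0<..<1}" "v \<in> {0<..<1}" "Fix (E u) = Fix (E v)" for u v
    proof -
      have "E u u = u" using G[OF that(1)] unfolding codes_def E_def by metis
      then have "u \<in> Fix (E u)" using that(1) unfolding Fix_def by auto
      then have "E v u = u" unfolding that(3) unfolding Fix_def by blast
      moreover have "codes (E v) (snd (G v)) (S v)" "snd (G v) 0 = v"
        using G[OF that(2)] unfolding E_def by blast+
      ultimately show ?thesis using codes_first_le[of "E v" "snd (G v)" "S v" u] that(1) by simp
    qed
    show ?thesis using le[OF r s eq] le[OF s r eq[symmetric]] by simp
  qed
  have "inj_on E {0<..<1}" by (rule inj_onI) (use FixE in metis)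
  moreover have "uncountable {0<..<1::real}" by (simp add: uncountable_open_interval)
  ultimately have "uncountable (E ` {0<..<1})" using countable_image_inj_on by blast
  moreover have "\<forall>f\<in>E ` {0<..<1}. interval_map f \<and> under_diagonal f \<and> crooked f"
    using good_imp_crooked G unfolding E_def by blast
  moreover have "\<not> conjugate (E r) (E s) \<and> Fix (E r) \<noteq> Fix (E s)"
    if "r \<in> {0<..<1}" "s \<in> {0<..<1}" "E r \<noteq> E s" for r s
    using that FixE[of r s] S_inj[of r s] G[of r] G[of s]
      conjugate_codes[of "E r" "snd (G r)" "S r" "E s" "snd (G s)" "S s"]
    unfolding E_def good_def by blast
  ultimately show ?thesis by (intro exI[of _ "E ` {0<..<1}"]) blast
qed

end
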